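(* Up to isomorphism, the commutative associative algebras of dimension $3$ over $\mathbb{R}$ (equivalently, the $3$-dimensional Novikov algebras over $\mathbb{R}$ with abelian associated Lie algebra) are exactly the following $15$ pairwise non-isomorphic algebras: $A_{3,i}$ for $1\le i\le5$; $\widetilde{A_{2,1}}$; $\widetilde{A_{2,2}}$; $\widetilde{A_0}\oplus\widetilde{A_0}\oplus\widetilde{A_0}$; $\widetilde{A_0}\oplus\widetilde{A_0}\oplus A_1$; $\widetilde{A_0}\oplus A_1\oplus A_1$; $\widetilde{A_1}\oplus A_1$; $\widetilde{A_1}\oplus\widetilde{A_0}$; $\mathbb{C}\oplus A_1$; $\mathbb{C}\oplus\widetilde{A_0}$; $A_{2,2}\oplus\widetilde{A_0}$. Over $\mathbb{C}$ there are, up to isomorphism, exactly $12$ commutative associative algebras of dimension $3$. They are obtained by extending scalars to $\mathbb{C}$ in the list of the $15$ real algebras $A_{3,i}$ ($1\le i\le5$), $\widetilde{A_{2,1}}$, $\widetilde{A_{2,2}}$, $\widetilde{A_0}\oplus\widetilde{A_0}\oplus\widetilde{A_0}$, $\widetilde{A_0}\oplus\widetilde{A_0}\oplus A_1$, $\widetilde{A_0}\oplus A_1\oplus A_1$, $\widetilde{A_1}\oplus A_1$, $\widetilde{A_1}\oplus\widetilde{A_0}$, $\mathbb{C}\oplus A_1$, $\mathbb{C}\oplus\widetilde{A_0}$, $A_{2,2}\oplus\widetilde{A_0}$, where exactly the pairs $A_{3,4},A_{3,5}$; and $\widetilde{A_0}\oplus\widetilde{A_0}\oplus\widetilde{A_0},\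 \mathbb{C}\oplus\widetilde{A_0}$; and $\widetilde{A_0}\oplus\widetilde{A_0}\oplus A_1,\ \mathbb{C}\oplus A_1$ become isomorphic, and there are no other isomorphisms.
   Context: Algebras are not assumed to have an identity element. A Novikov algebra is a vector space with bilinear product satisfying $x(yz)-(xy)z=y(xz)-(yx)z$ and $(xy)z=(xz)y$; its associated Lie algebra has bracket $[x,y]=xy-yx$. A Novikov algebra has abelian associated Lie algebra if and only if it is commutative and associative. For an algebra $A$ over $F$ without identity (including the zero algebra), $\widetilde{A}=A\oplus\langle 1\rangle$ denotes the algebra obtained by adjoining an identity element $1$, i.e. $a\cdot1=1\cdot a=a$ for all $a\in A$ and $1\cdot 1=1$. The symbol $\oplus$ between algebras denotes the direct sum of algebras (each summand an ideal). The nilpotent commutative associative algebras used are as follows; only nonzero products of basis elements are listed, up to commutativity. $A_0$ is the zero algebra of dimension $0$; $A_1$ has dimension $1$ with zero product; $A_{2,1}$ has dimension $2$ with zero product; $A_{2,2}$ has basis $e_1,e_2$ with $e_1^2=e_2$. With basis $e_1,e_2,e_3$: $A_{3,1}$ has zero product; $A_{3,2}$: $e_1^2=e_2$; $A_{3,3}$: $e_1^2=e_2$, $e_1e_2=e_3$; $A_{3,4}$: $e_1^2=e_3$, $e_2^2=e_3$; $A_{3,5}$: $e_1^2=-e_3$, $e_2^2=e_3$. As a real algebra, $\mathbb{C}$ has basis $e_1,e_2$ with $e_1^2=e_1$, $e_1e_2=e_2e_1=e_2$, $e_2^2=-e_1$. *)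

theory Defs
  imports "HOL-Analysis.Analysis"
begin

text \<open>The one-element group, needed as underlying space of the zero-dimensional algebra.
  Difference and negation on \<^typ>\<open>unit\<close> already exist in the library.\<close>

instantiation unit :: ab_group_add
begin

definition zero_unit :: unit where "0 = ()"
definition plus_unit :: "unit \<Rightarrow> unit \<Rightarrow> unit" where "x + y = ()"

instance by standard simp_all

end


section \<open>Algebras\<close>

text \<open>The additive group is that of the type \<open>'a\<close>; scalar multiplication and product are part of
  the structure. There is no identity element, and no associativity is built in.\<close>

record ('k, 'a) alg =
  scl :: "'k \<Rightarrow> 'a \<Rightarrow> 'a"
  mul :: "'a \<Rightarrow> 'a \<Rightarrow> 'a"

definition is_algebra :: "('k::field, 'a::ab_group_add) alg \<Rightarrow> bool" where
  "is_algebra A \<longleftrightarrow> vector_space (scl A)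
     \<and> (\<forall>x. Vector_Spaces.linear (scl A) (scl A) (\<lambda>y. mul A x y))
     \<and> (\<forall>y. Vector_Spaces.linear (scl A) (scl A) (\<lambda>x. mul A x y))"

text \<open>The library's \<open>dim\<close> is \<open>0\<close> on infinite-dimensional spaces; a positive value
  means a finite basis of that size.\<close>

definition alg_dim :: "('k::field, 'a::ab_group_add) alg \<Rightarrow> nat" where
  "alg_dim A = vector_space.dim (scl A) UNIV"

definition commutative :: "('k, 'a) alg \<Rightarrow> bool" where
  "commutative A \<longleftrightarrow> (\<forall>x y. mul A x y = mul A y x)"

definition associative :: "('k, 'a) alg \<Rightarrow> bool" where
  "associative A \<longleftrightarrow> (\<forall>x y z. mul A (mul A x y) z = mul A x (mul A y z))"

definition novikov :: "('k::field, 'a::ab_group_add) alg \<Rightarrow> bool" where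
  "novikov A \<longleftrightarrow> is_algebra A
     \<and> (\<forall>x y z. mul A x (mul A y z) - mul A (mul A x y) z
                = mul A y (mul A x z) - mul A (mul A y x) z)
     \<and> (\<forall>x y z. mul A (mul A x y) z = mul A (mul A x z) y)"

definition lie_bracket :: "('k, 'a::ab_group_add) alg \<Rightarrow> 'a \<Rightarrow> 'a \<Rightarrow> 'a" where
  "lie_bracket A x y = mul A x y - mul A y x"

definition lie_abelian :: "('k, 'a::ab_group_add) alg \<Rightarrow> bool" where
  "lie_abelian A \<longleftrightarrow> (\<forall>x y. lie_bracket A x y = 0)"

definition ca_algebra :: "nat \<Rightarrow> ('k::field, 'a::ab_group_add) alg \<Rightarrow> bool" where
  "ca_algebra n A \<longleftrightarrow> is_algebra A \<and> alg_dim A = n \<and> commutative A \<and> associative A"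

definition isomorphic ::
    "('k::field, 'a::ab_group_add) alg \<Rightarrow> ('k, 'b::ab_group_add) alg \<Rightarrow> bool" where
  "isomorphic A B \<longleftrightarrow> (\<exists>f. Vector_Spaces.linear (scl A) (scl B) f \<and> bij f
     \<and> (\<forall>x y. f (mul A x y) = mul B (f x) (f y)))"

text \<open>Isomorphism classes of \<open>n\<close>-dimensional commutative associative algebras with underlying
  additive group \<open>'a\<close>.\<close>

definition ca_iso_classes :: "nat \<Rightarrow> ('k::field, 'a::ab_group_add) alg set set" where
  "ca_iso_classes n = {A. ca_algebra n A} // {(A, B). isomorphic A B}"


section \<open>Constructions\<close>

text \<open>In \<open>adjoin_one A\<close>, the pair \<open>(a, s)\<close> stands for \<open>a + s\<cdot>1\<close>.\<close>

definition adjoin_one :: "('k::field, 'a::ab_group_add) alg \<Rightarrow> ('k, 'a \<times> 'k) alg" where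
  "adjoin_one A =
    \<lparr> scl = (\<lambda>c (a, s). (scl A c a, c * s)),
      mul = (\<lambda>(a, s) (b, t). (mul A a b + scl A s b + scl A t a, s * t)) \<rparr>"

definition direct_sum :: "('k, 'a) alg \<Rightarrow> ('k, 'b) alg \<Rightarrow> ('k, 'a \<times> 'b) alg"
    (infixr "\<boxplus>" 65) where
  "A \<boxplus> B =
    \<lparr> scl = (\<lambda>c (a, b). (scl A c a, scl B c b)),
      mul = (\<lambda>(a, b) (a', b'). (mul A a a', mul B b b')) \<rparr>"

text \<open>Extension of scalars from the reals to the complex numbers: the pair \<open>(x, y)\<close>
  stands for \<open>1 \<otimes> x + \<i> \<otimes> y\<close>.\<close>

definition complexify :: "(real, 'a::ab_group_add) alg \<Rightarrow> (complex, 'a \<times> 'a) alg" where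
  "complexify A =
    \<lparr> scl = (\<lambda>c (x, y). (scl A (Re c) x - scl A (Im c) y, scl A (Re c) y + scl A (Im c) x)),
      mul = (\<lambda>(x, y) (x', y'). (mul A x x' - mul A y y', mul A x y' + mul A y x')) \<rparr>"

text \<open>Transport of structure along an additive bijection.\<close>

definition transport :: "('b \<Rightarrow> 'a) \<Rightarrow> ('k, 'a) alg \<Rightarrow> ('k, 'b) alg" where
  "transport \<phi> A =
    \<lparr> scl = (\<lambda>c x. inv \<phi> (scl A c (\<phi> x))),
      mul = (\<lambda>x y. inv \<phi> (mul A (\<phi> x) (\<phi> y))) \<rparr>"


section \<open>The basic algebras\<close>

text \<open>Multiplication tables in coordinates with respect to the basis \<open>e\<^sub>1, e\<^sub>2, \<dots>\<close>.\<close>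

definition A0 :: "('k::field, unit) alg" where
  "A0 = \<lparr> scl = (\<lambda>_ _. 0), mul = (\<lambda>_ _. 0) \<rparr>"

definition A1 :: "('k::field, 'k) alg" where
  "A1 = \<lparr> scl = (*), mul = (\<lambda>_ _. 0) \<rparr>"

definition A21 :: "('k::field, 'k ^ 2) alg" where
  "A21 = \<lparr> scl = (*s), mul = (\<lambda>_ _. 0) \<rparr>"

definition A22 :: "('k::field, 'k ^ 2) alg" where
  "A22 = \<lparr> scl = (*s), mul = (\<lambda>x y. vector [0, x$1 * y$1]) \<rparr>"

definition A31 :: "('k::field, 'k ^ 3) alg" where
  "A31 = \<lparr> scl = (*s), mul = (\<lambda>_ _. 0) \<rparr>"

definition A32 :: "('k::field, 'k ^ 3) alg" where
  "A32 = \<lparr> scl = (*s), mul = (\<lambda>x y. vector [0, x$1 * y$1, 0]) \<rparr>"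

definition A33 :: "('k::field, 'k ^ 3) alg" where
  "A33 = \<lparr> scl = (*s), mul = (\<lambda>x y. vector [0, x$1 * y$1, x$1 * y$2 + x$2 * y$1]) \<rparr>"

definition A34 :: "('k::field, 'k ^ 3) alg" where
  "A34 = \<lparr> scl = (*s), mul = (\<lambda>x y. vector [0, 0, x$1 * y$1 + x$2 * y$2]) \<rparr>"

definition A35 :: "('k::field, 'k ^ 3) alg" where
  "A35 = \<lparr> scl = (*s), mul = (\<lambda>x y. vector [0, 0, - (x$1 * y$1) + x$2 * y$2]) \<rparr>"

text \<open>The complex numbers as a real algebra, with \<open>e\<^sub>1 = 1\<close> and \<open>e\<^sub>2 = \<i>\<close>.\<close>

definition CC :: "(real, complex) alg" where
  "CC = \<lparr> scl = (*\<^sub>R), mul = (*) \<rparr>"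


section \<open>The list\<close>

text \<open>In the names, a suffix \<open>u\<close> marks an adjoined identity and underscores separate the
  direct summands. The algebras live on different types; each is transported
  to \<^typ>\<open>real ^ 3\<close> along the evident linear bijection so that they form one family.\<close>

datatype alg_name =
    L_A31 | L_A32 | L_A33 | L_A34 | L_A35
  | L_A21u | L_A22u
  | L_A0u_A0u_A0u | L_A0u_A0u_A1 | L_A0u_A1_A1
  | L_A1u_A1 | L_A1u_A0u
  | L_C_A1 | L_C_A0u
  | L_A22_A0u

fun listed :: "alg_name \<Rightarrow> (real, real ^ 3) alg" where
  "listed L_A31 = A31"
| "listed L_A32 = A32"
| "listed L_A33 = A33"
| "listed L_A34 = A34"
| "listed L_A35 = A35"
| "listed L_A21u = transport (\<lambda>v. (vector [v$1, v$2], v$3)) (adjoin_one A21)"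
| "listed L_A22u = transport (\<lambda>v. (vector [v$1, v$2], v$3)) (adjoin_one A22)"
| "listed L_A0u_A0u_A0u = transport (\<lambda>v. (((), v$1), ((), v$2), ((), v$3)))
     (adjoin_one A0 \<boxplus> adjoin_one A0 \<boxplus> adjoin_one A0)"
| "listed L_A0u_A0u_A1 = transport (\<lambda>v. (((), v$1), ((), v$2), v$3))
     (adjoin_one A0 \<boxplus> adjoin_one A0 \<boxplus> A1)"
| "listed L_A0u_A1_A1 = transport (\<lambda>v. (((), v$1), v$2, v$3)) (adjoin_one A0 \<boxplus> A1 \<boxplus> A1)"
| "listed L_A1u_A1 = transport (\<lambda>v. ((v$1, v$2), v$3)) (adjoin_one A1 \<boxplus> A1)"
| "listed L_A1u_A0u = transport (\<lambda>v. ((v$1, v$2), ((), v$3))) (adjoin_one A1 \<boxplus> adjoin_one A0)"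
| "listed L_C_A1 = transport (\<lambda>v. (Complex (v$1) (v$2), v$3)) (CC \<boxplus> A1)"
| "listed L_C_A0u = transport (\<lambda>v. (Complex (v$1) (v$2), ((), v$3))) (CC \<boxplus> adjoin_one A0)"
| "listed L_A22_A0u = transport (\<lambda>v. (vector [v$1, v$2], ((), v$3))) (A22 \<boxplus> adjoin_one A0)"


subsection \<open>The transported algebras are isomorphic to the original ones\<close>

lemma transport_isomorphic:
  fixes A :: "('k::field, 'a::ab_group_add) alg" and \<phi> :: "'b::ab_group_add \<Rightarrow> 'a"
  assumes A: "vector_space (scl A)"
    and add: "\<And>x y. \<phi> (x + y) = \<phi> x + \<phi> y" and bij: "bij \<phi>"
  shows "isomorphic (transport \<phi> A) A"
proof -
  have inj: "inj \<phi>" and f_inv: "\<And>y. \<phi> (inv \<phi> y) = y"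
    using bij by (simp_all add: bij_def surj_f_inv_f)
  have eqI: "x = y" if "\<phi> x = \<phi> y" for x y using inj that by (simp add: inj_eq)
  interpret vector_space "scl A" by (rule A)
  interpret T: vector_space "scl (transport \<phi> A)"
    by unfold_locales
      (rule eqI, simp add: transport_def f_inv add scale_right_distrib scale_left_distrib)+
  have "Vector_Spaces.linear (scl (transport \<phi> A)) (scl A) \<phi>"
    by unfold_locales (simp_all add: transport_def f_inv add)
  then show ?thesis
    unfolding isomorphic_def using bij by (intro exI[of _ \<phi>]) (simp add: transport_def f_inv)
qed

lemma vs_A0: "vector_space (scl (A0 :: ('k::field, unit) alg))"
  by unfold_locales (simp_all add: A0_def)

lemma vs_A1: "vector_space (scl (A1 :: ('k::field, 'k) alg))"
  by unfold_locales (simp_all add: A1_def algebra_simps)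

lemma vs_A21: "vector_space (scl (A21 :: ('k::field, 'k ^ 2) alg))"
  by unfold_locales (simp_all add: A21_def vec_eq_iff algebra_simps)

lemma vs_A22: "vector_space (scl (A22 :: ('k::field, 'k ^ 2) alg))"
  by unfold_locales (simp_all add: A22_def vec_eq_iff algebra_simps)

lemma vs_CC: "vector_space (scl CC)"
  by unfold_locales (simp_all add: CC_def algebra_simps)

lemma vs_adjoin_one:
  assumes "vector_space (scl A)" shows "vector_space (scl (adjoin_one A))"
proof -
  interpret vector_space "scl A" by fact
  show ?thesis
    by unfold_locales
      (auto simp: adjoin_one_def algebra_simps scale_right_distrib scale_left_distrib)
qed

lemma vs_direct_sum:
  assumes "vector_space (scl A)" "vector_space (scl B)" shows "vector_space (scl (A \<boxplus> B))"
proof -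
  interpret A: vector_space "scl A" by fact
  interpret B: vector_space "scl B" by fact
  show ?thesis
    by unfold_locales
      (auto simp: direct_sum_def A.scale_right_distrib A.scale_left_distrib
        B.scale_right_distrib B.scale_left_distrib)
qed

lemmas vs_intros = vs_A0 vs_A1 vs_A21 vs_A22 vs_CC vs_adjoin_one vs_direct_sum

lemma listed_isomorphic:
  "isomorphic (listed L_A21u) (adjoin_one A21)"
  "isomorphic (listed L_A22u) (adjoin_one A22)"
  "isomorphic (listed L_A0u_A0u_A0u) (adjoin_one A0 \<boxplus> adjoin_one A0 \<boxplus> adjoin_one A0)"
  "isomorphic (listed L_A0u_A0u_A1) (adjoin_one A0 \<boxplus> adjoin_one A0 \<boxplus> A1)"
  "isomorphic (listed L_A0u_A1_A1) (adjoin_one A0 \<boxplus> A1 \<boxplus> A1)"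
  "isomorphic (listed L_A1u_A1) (adjoin_one A1 \<boxplus> A1)"
  "isomorphic (listed L_A1u_A0u) (adjoin_one A1 \<boxplus> adjoin_one A0)"
  "isomorphic (listed L_C_A1) (CC \<boxplus> A1)"
  "isomorphic (listed L_C_A0u) (CC \<boxplus> adjoin_one A0)"
  "isomorphic (listed L_A22_A0u) (A22 \<boxplus> adjoin_one A0)"
proof -
  have two: "\<exists>v :: real ^ 3. (vector [v$1, v$2] :: real ^ 2) = w \<and> v$3 = c" for w c
    by (rule exI[of _ "vector [w$1, w$2, c]"]) (simp add: vec_eq_iff forall_2)
  have three: "\<exists>v :: real ^ 3. v$1 = a \<and> v$2 = b \<and> v$3 = c" for a b c
    by (rule exI[of _ "vector [a, b, c]"]) simp
  have surj: "surj f" if "\<And>y. \<exists>x. f x = y" for f :: "real ^ 3 \<Rightarrow> 'z"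
    using that by (metis surjI)
  note simps = vec_eq_iff forall_2 forall_3 complex_eq_iff two three
  show
    "isomorphic (listed L_A21u) (adjoin_one A21)"
    "isomorphic (listed L_A22u) (adjoin_one A22)"
    "isomorphic (listed L_A0u_A0u_A0u) (adjoin_one A0 \<boxplus> adjoin_one A0 \<boxplus> adjoin_one A0)"
    "isomorphic (listed L_A0u_A0u_A1) (adjoin_one A0 \<boxplus> adjoin_one A0 \<boxplus> A1)"
    "isomorphic (listed L_A0u_A1_A1) (adjoin_one A0 \<boxplus> A1 \<boxplus> A1)"
    "isomorphic (listed L_A1u_A1) (adjoin_one A1 \<boxplus> A1)"
    "isomorphic (listed L_A1u_A0u) (adjoin_one A1 \<boxplus> adjoin_one A0)"
    "isomorphic (listed L_C_A1) (CC \<boxplus> A1)"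
    "isomorphic (listed L_C_A0u) (CC \<boxplus> adjoin_one A0)"
    "isomorphic (listed L_A22_A0u) (A22 \<boxplus> adjoin_one A0)"
    unfolding listed.simps
    by (rule transport_isomorphic; (intro vs_intros bijI injI surj)?;
        clarsimp simp: simps)+
qed

end

theory Submission
  imports Defs "HOL-Computational_Algebra.Fundamental_Theorem_Algebra"
begin

text \<open>The multiplication tables of the fifteen algebras make sense over every field. Over the reals
  they give the listed algebras, and extension of scalars turns the real table into the same table
  over the complex numbers (\<open>listed_eq_model\<close>, \<open>complexify_model\<close>). Everything can therefore be
  proved for tables.

  Completeness (\<open>ca3.classification\<close>) is proved once, over any field of characteristic \<open>0\<close> in
  which every element is a square or minus a square and every cubic has a root; both the reals and
  the complex numbers are of this kind. In an algebra \<open>A\<close> of dimension \<open>3\<close> the elements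
  \<open>x, x\<^sup>2, x\<^sup>3, x\<^sup>4\<close> are dependent, so either \<open>x\<^sup>4 = 0\<close> or a multiple of \<open>x\<close> is a nonzero idempotent
  (\<open>idempotent_multiple_or_nilpotent\<close>). Without idempotents, \<open>A\<close> is generated by one element with
  \<open>x\<^sup>3 \<noteq> 0\<close>, or all triple products vanish by polarisation; then the product is a symmetric bilinear
  form with values in a line, and it can be diagonalised. These are the algebras \<open>A\<^sub>3\<^sub>i\<close>.

  An idempotent \<open>e\<close> splits \<open>A\<close> into the ideals \<open>eA\<close> and \<open>{x. ex = 0}\<close>. If \<open>eA\<close> is a plane, it has
  a basis \<open>e, v\<close> with \<open>v\<^sup>2\<close> a multiple of \<open>e\<close>, by completing the square, and \<open>v\<^sup>2 = e\<close>, \<open>v\<^sup>2 = 0\<close>,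
  \<open>v\<^sup>2 = -e\<close> are the only cases; the complement is a line on which the product is zero or that of
  the field. This accounts for six algebras. If no idempotent has this shape, then \<open>e\<close> is the
  identity or \<open>eA\<close> is a line. When there is an identity, it is the only nonzero idempotent, because
  otherwise \<open>A\<close> would be spanned by \<open>f\<close> and \<open>e - f\<close>; every element has an eigenvalue, so \<open>A\<close> is local
  and is determined by its maximal ideal, a plane of nilpotent elements. When \<open>eA\<close> is a line for
  every nonzero idempotent, the annihilator of \<open>e\<close> is such a plane. There are two such planes
  (\<open>nil_plane_basis\<close>), which gives the last four algebras.

  Nonisomorphism uses properties that refer only to the operations, for instance having an identity
  or having \<open>x\<^sup>3 = 0\<close> imply \<open>x\<^sup>2 = 0\<close>. A decision tree of such properties
  (\<open>iso_class\<close>) has the same twelve values over every field of characteristic \<open>0\<close>; the three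
  pairs of tables on which it agrees are isomorphic over the complex numbers, through \<open>\<i>\<close>, and are
  told apart over the reals by the solvability of \<open>x\<^sup>2 = 0\<close> outside the annihilator of the
  algebra, or of \<open>x\<^sup>3 = -x\<close> with \<open>x \<noteq> 0\<close>.\<close>

section \<open>Isomorphic algebras\<close>

lemma isomorphic_refl:
  assumes "vector_space (scl A)" shows "isomorphic A A"
proof -
  interpret vector_space "scl A" by (rule assms)
  show ?thesis unfolding isomorphic_def by (intro exI[of _ "\<lambda>x. x"]) (simp add: linear_ident bij_def)
qed

lemma isomorphic_sym:
  assumes "isomorphic A B" shows "isomorphic B A"
proof -
  obtain f where lin: "Vector_Spaces.linear (scl A) (scl B) f" and bij: "bij f"
    and hom: "\<And>x y. f (mul A x y) = mul B (f x) (f y)"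
    using assms by (auto simp: isomorphic_def)
  interpret Vector_Spaces.linear "scl A" "scl B" f by (rule lin)
  have inv: "inv f (f x) = x" "f (inv f y) = y" for x y
    using bij by (simp_all add: bij_is_inj bij_is_surj surj_f_inv_f)
  have eqI: "x = y" if "f x = f y" for x y
    using that bij by (simp add: bij_is_inj inj_eq)
  have "Vector_Spaces.linear (scl B) (scl A) (inv f)"
    by unfold_locales (rule eqI, simp add: add scale inv)+
  then show ?thesis
    unfolding isomorphic_def
    by (intro exI[of _ "inv f"] conjI bij_imp_bij_inv[OF bij] allI eqI) (simp_all add: hom inv)
qed

lemma isomorphic_trans:
  assumes "isomorphic A B" "isomorphic B C" shows "isomorphic A C"
proof -
  obtain f g where f: "Vector_Spaces.linear (scl A) (scl B) f" "bij f"
      "\<And>x y. f (mul A x y) = mul B (f x) (f y)"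
    and g: "Vector_Spaces.linear (scl B) (scl C) g" "bij g"
      "\<And>x y. g (mul B x y) = mul C (g x) (g y)"
    using assms by (auto simp: isomorphic_def)
  show ?thesis
    unfolding isomorphic_def
    using Vector_Spaces.linear_compose[OF f(1) g(1)] bij_comp[OF f(2) g(2)] f(3) g(3)
    by (intro exI[of _ "g \<circ> f"]) simp
qed

lemma alg_dim_isomorphic:
  assumes "isomorphic A B" "alg_dim A > 0" shows "alg_dim B = alg_dim A"
proof -
  obtain f where lin: "Vector_Spaces.linear (scl A) (scl B) f" and bij: "bij f"
    using assms by (auto simp: isomorphic_def)
  interpret f: Vector_Spaces.linear "scl A" "scl B" f by (rule lin)
  obtain S where S: "f.vs1.independent S" "f.vs1.span S = UNIV" "card S = alg_dim A"
    unfolding alg_dim_def by (metis f.vs1.basis_exists top.extremum_uniqueI)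
  have "f.vs2.independent (f ` S)"
    using f.independent_inj_image[OF S(1)] bij bij_is_inj by blast
  moreover have "f.vs2.span (f ` S) = UNIV"
    using f.span_image[of S] S(2) bij by (simp add: bij_is_surj)
  moreover have "card (f ` S) = alg_dim A"
    using S(3) card_image[OF inj_on_subset[OF bij_is_inj[OF bij] subset_UNIV]] by simp
  ultimately show ?thesis
    unfolding alg_dim_def[of B] by (metis f.vs2.dim_unique subset_UNIV order_refl)
qed

lemma ca_algebra_isomorphic:
  assumes iso: "isomorphic A B" and ca: "ca_algebra n A" and n: "n > 0"
  shows "ca_algebra n B"
proof -
  have AB: "isomorphic B A" using iso by (rule isomorphic_sym)
  then obtain f where lin: "Vector_Spaces.linear (scl B) (scl A) f" and bij: "bij f"
    and hom: "\<And>x y. f (mul B x y) = mul A (f x) (f y)"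
    by (auto simp: isomorphic_def)
  interpret f: Vector_Spaces.linear "scl B" "scl A" f by (rule lin)
  have eqI: "x = y" if "f x = f y" for x y
    using that bij by (simp add: bij_is_inj inj_eq)
  have A: "Vector_Spaces.linear (scl A) (scl A) (\<lambda>y. mul A x y)"
    "Vector_Spaces.linear (scl A) (scl A) (\<lambda>y. mul A y x)" for x
    using ca by (auto simp: ca_algebra_def is_algebra_def)
  interpret l: Vector_Spaces.linear "scl A" "scl A" "\<lambda>y. mul A x y" for x by (rule A)
  interpret r: Vector_Spaces.linear "scl A" "scl A" "\<lambda>y. mul A y x" for x by (rule A)
  have "Vector_Spaces.linear (scl B) (scl B) (\<lambda>y. mul B x y)"
    "Vector_Spaces.linear (scl B) (scl B) (\<lambda>y. mul B y x)" for x
    by (unfold_locales; rule eqI; simp add: hom f.add f.scale l.add l.scale r.add r.scale)+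
  then have "is_algebra B"
    by (simp add: is_algebra_def f.vs1.vector_space_axioms)
  moreover have "commutative B"
    unfolding commutative_def
    by (intro allI eqI) (use ca in \<open>auto simp: hom ca_algebra_def commutative_def\<close>)
  moreover have "associative B"
    unfolding associative_def
    by (intro allI eqI) (use ca in \<open>simp add: hom ca_algebra_def associative_def\<close>)
  ultimately show ?thesis
    using ca alg_dim_isomorphic[OF iso] n by (simp add: ca_algebra_def)
qed

text \<open>With a commutative product, right commutativity \<open>(xy)z = (xz)y\<close> is associativity up to the
  order of the factors, and left symmetry follows from it.\<close>

lemma novikov_lie_abelian_iff:
  assumes "is_algebra A"
  shows "novikov A \<and> lie_abelian A \<longleftrightarrow> commutative A \<and> associative A"
proof
  assume *: "novikov A \<and> lie_abelian A"
  then have com: "mul A x y = mul A y x" for x y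
    by (simp add: lie_abelian_def lie_bracket_def)
  have rc: "mul A (mul A x y) z = mul A (mul A x z) y" for x y z
    using * by (simp add: novikov_def)
  have "mul A (mul A x y) z = mul A x (mul A y z)" for x y z
    using com rc by metis
  then show "commutative A \<and> associative A"
    using com unfolding commutative_def associative_def by blast
next
  assume *: "commutative A \<and> associative A"
  then have com: "mul A x y = mul A y x" and as: "mul A (mul A x y) z = mul A x (mul A y z)" for x y z
    unfolding commutative_def associative_def by blast+
  have "mul A x (mul A y z) = mul A y (mul A x z)" for x y z
    using com as by metis
  then show "novikov A \<and> lie_abelian A"
    using assms com as by (auto simp: novikov_def lie_abelian_def lie_bracket_def)
qed

section \<open>The fifteen multiplication tables over an arbitrary field\<close>

text \<open>The tables refer to the coordinates in which the listed algebras are transported to the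
  space of triples; in particular an adjoined identity occupies the last coordinate of its summand.\<close>

fun mprod :: "alg_name \<Rightarrow> ('k::field) ^ 3 \<Rightarrow> 'k ^ 3 \<Rightarrow> 'k ^ 3" where
  "mprod L_A31 x y = vector [0, 0, 0]"
| "mprod L_A32 x y = vector [0, x$1 * y$1, 0]"
| "mprod L_A33 x y = vector [0, x$1 * y$1, x$1 * y$2 + x$2 * y$1]"
| "mprod L_A34 x y = vector [0, 0, x$1 * y$1 + x$2 * y$2]"
| "mprod L_A35 x y = vector [0, 0, - (x$1 * y$1) + x$2 * y$2]"
| "mprod L_A21u x y = vector [x$1 * y$3 + x$3 * y$1, x$2 * y$3 + x$3 * y$2, x$3 * y$3]"
| "mprod L_A22u x y = vector [x$1 * y$3 + x$3 * y$1, x$1 * y$1 + x$2 * y$3 + x$3 * y$2, x$3 * y$3]"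
| "mprod L_A0u_A0u_A0u x y = vector [x$1 * y$1, x$2 * y$2, x$3 * y$3]"
| "mprod L_A0u_A0u_A1 x y = vector [x$1 * y$1, x$2 * y$2, 0]"
| "mprod L_A0u_A1_A1 x y = vector [x$1 * y$1, 0, 0]"
| "mprod L_A1u_A1 x y = vector [x$1 * y$2 + x$2 * y$1, x$2 * y$2, 0]"
| "mprod L_A1u_A0u x y = vector [x$1 * y$2 + x$2 * y$1, x$2 * y$2, x$3 * y$3]"
| "mprod L_C_A1 x y = vector [x$1 * y$1 - x$2 * y$2, x$1 * y$2 + x$2 * y$1, 0]"
| "mprod L_C_A0u x y = vector [x$1 * y$1 - x$2 * y$2, x$1 * y$2 + x$2 * y$1, x$3 * y$3]"
| "mprod L_A22_A0u x y = vector [0, x$1 * y$1, x$3 * y$3]"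

definition model :: "alg_name \<Rightarrow> ('k::field, 'k ^ 3) alg" where
  "model i = \<lparr> scl = (*s), mul = mprod i \<rparr>"

lemmas vec_simps = vec_eq_iff forall_3

type_synonym 'k alg3 = "('k, 'k ^ 3) alg"

lemma model_simps [simp]: "scl (model i) = (*s)" "mul (model i) = mprod i"
  by (simp_all add: model_def)

lemma ca_algebra_model: "ca_algebra 3 (model i :: ('k::field, 'k ^ 3) alg)" (is "ca_algebra 3 ?M")
proof -
  have "alg_dim ?M = 3"
    by (simp only: alg_dim_def model_simps vec_dim_card) simp
  moreover have "Vector_Spaces.linear (*s) (*s) (\<lambda>y. mprod i x y)"
    "Vector_Spaces.linear (*s) (*s) (\<lambda>y. mprod i y x)" for x :: "'k ^ 3"
    by (unfold_locales; cases i; simp add: vec_eq_iff forall_3 algebra_simps)+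
  moreover have "commutative ?M"
    unfolding commutative_def by (cases i; simp add: vec_eq_iff forall_3 algebra_simps)
  moreover have "associative ?M"
    unfolding associative_def by (cases i; simp add: vec_eq_iff forall_3 algebra_simps)
  ultimately show ?thesis
    by (simp add: ca_algebra_def is_algebra_def vec.vector_space_axioms)
qed

lemma transport_eq_model:
  assumes inj: "\<And>x y. \<phi> x = \<phi> y \<Longrightarrow> x = y"
    and s: "\<And>c x. \<phi> (c *s x) = scl A c (\<phi> x)"
    and m: "\<And>x y. \<phi> (mprod i x y) = mul A (\<phi> x) (\<phi> y)"
  shows "transport \<phi> A = model i"
proof -
  have [simp]: "inv \<phi> (\<phi> x) = x" for x by (rule inv_f_f) (auto intro: injI inj)
  show ?thesis by (simp add: transport_def model_def m[symmetric] s[symmetric])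
qed

lemma listed_eq_model: "listed i = model i"
  apply (cases i; hypsubst; subst listed.simps)
  apply (simp_all add: A31_def A32_def A33_def A34_def A35_def model_def fun_eq_iff vec_eq_iff forall_3)[5]
  apply (rule transport_eq_model;
       simp add: adjoin_one_def direct_sum_def A0_def A1_def A21_def A22_def CC_def
         complex_eq_iff vec_eq_iff forall_2 forall_3)+
  done

lemma complexify_model: "isomorphic (complexify (model i)) (model i)"
proof -
  define f :: "(real ^ 3) \<times> (real ^ 3) \<Rightarrow> complex ^ 3"
    where "f = (\<lambda>(x, y). \<chi> j. Complex (x $ j) (y $ j))"
  define A where "A = complexify (model i)"
  have eqI: "x = y" if "f x = f y" for x y
    using that by (cases x; cases y) (simp add: f_def vec_eq_iff)
  have "surj f"
    by (rule surjI[of _ "\<lambda>v. (\<chi> j. Re (v $ j), \<chi> j. Im (v $ j))"]) (simp add: f_def vec_eq_iff)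
  then have bij: "bij f" using eqI by (intro bijI injI)
  have add: "f (x + y) = f x + f y" for x y
    by (cases x; cases y) (simp add: f_def vec_eq_iff complex_eq_iff)
  have scale: "f (scl A c x) = c *s f x" for c x
    by (cases x) (simp add: f_def A_def complexify_def vec_eq_iff complex_eq_iff algebra_simps)
  have hom: "f (mul A x y) = mprod i (f x) (f y)" for x y
    by (cases x; cases y; cases i)
      (simp_all add: f_def A_def complexify_def vec_eq_iff forall_3 complex_eq_iff algebra_simps)
  interpret vector_space "scl A"
    by unfold_locales (rule eqI, simp add: add scale algebra_simps vec_eq_iff)+
  have "Vector_Spaces.linear (scl A) (*s) f"
    by unfold_locales (simp_all add: add scale)
  then show ?thesis
    unfolding isomorphic_def A_def[symmetric] using bij hom by (intro exI[of _ f]) simp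
qed

section \<open>Bases of three-dimensional commutative associative algebras\<close>

text \<open>The last two assumptions are all that the classification needs to know about the field.
  The first of them normalises quadratic forms up to sign, the second provides eigenvalues.\<close>

locale ca3 =
  fixes A :: "('k::field_char_0, 'a::ab_group_add) alg"
  assumes ca: "ca_algebra 3 A"
    and square: "\<And>b :: 'k. \<exists>s. s * s = b \<or> s * s = - b"
    and cubic: "\<And>p q r :: 'k. \<exists>t. t ^ 3 + p * t ^ 2 + q * t + r = 0"
begin

abbreviation smul (infixr "\<cdot>" 75) where "c \<cdot> x \<equiv> scl A c x"
abbreviation prod (infixl "\<star>" 72) where "x \<star> y \<equiv> mul A x y"

sublocale vector_space "scl A"
  using ca by (simp add: ca_algebra_def is_algebra_def)

lemma prod_add_right: "x \<star> (y + z) = x \<star> y + x \<star> z"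
  and prod_scale_right: "x \<star> (c \<cdot> y) = c \<cdot> (x \<star> y)"
proof -
  interpret Vector_Spaces.linear "scl A" "scl A" "\<lambda>y. x \<star> y"
    using ca by (auto simp: ca_algebra_def is_algebra_def)
  show "x \<star> (y + z) = x \<star> y + x \<star> z" "x \<star> (c \<cdot> y) = c \<cdot> (x \<star> y)"
    by (rule add scale)+
qed

sublocale prod: abel_semigroup "mul A"
  using ca by unfold_locales (auto simp: ca_algebra_def commutative_def associative_def)

lemma prod_add_left: "(y + z) \<star> x = y \<star> x + z \<star> x"
  and prod_scale_left: "(c \<cdot> y) \<star> x = c \<cdot> (y \<star> x)"
  by (simp_all add: prod.commute[of _ x] prod_add_right prod_scale_right)

lemma prod_zero [simp]: "x \<star> 0 = 0" "0 \<star> x = 0"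
  using prod_scale_right[of x 0 x] prod_scale_left[of 0 x x] by simp_all

lemma prod_minus: "x \<star> (- y) = - (x \<star> y)" "(- y) \<star> x = - (y \<star> x)"
  using prod_scale_right[of x "-1" y] prod_scale_left[of "-1" y x] by simp_all

lemma prod_diff: "x \<star> (y - z) = x \<star> y - x \<star> z" "(y - z) \<star> x = y \<star> x - z \<star> x"
  unfolding diff_conv_add_uminus by (simp_all only: prod_add_right prod_add_left prod_minus)

lemmas bilinear = prod_add_right prod_add_left prod_scale_right prod_scale_left prod_minus prod_diff

definition indep3 :: "'a \<Rightarrow> 'a \<Rightarrow> 'a \<Rightarrow> bool" where
  "indep3 a b c \<longleftrightarrow> (\<forall>\<alpha> \<beta> \<gamma>. \<alpha> \<cdot> a + \<beta> \<cdot> b + \<gamma> \<cdot> c = 0 \<longrightarrow> \<alpha> = 0 \<and> \<beta> = 0 \<and> \<gamma> = 0)"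

lemma indep3D:
  assumes "indep3 a b c" "\<alpha> \<cdot> a + \<beta> \<cdot> b + \<gamma> \<cdot> c = 0"
  shows "\<alpha> = 0" "\<beta> = 0" "\<gamma> = 0"
  using assms by (auto simp: indep3_def)

lemma indep3_nonzero:
  assumes "indep3 a b c" shows "a \<noteq> 0" "b \<noteq> 0" "c \<noteq> 0"
  using indep3D[OF assms, of 1 0 0] indep3D[OF assms, of 0 1 0] indep3D[OF assms, of 0 0 1] by auto

lemma indep3I:
  assumes "\<And>\<alpha> \<beta> \<gamma>. \<alpha> \<cdot> a + \<beta> \<cdot> b + \<gamma> \<cdot> c = 0 \<Longrightarrow> \<alpha> = 0 \<and> \<beta> = 0 \<and> \<gamma> = 0"
  shows "indep3 a b c"
  using assms unfolding indep3_def by blast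

lemma indep3_rotate:
  assumes "indep3 a b c" shows "indep3 b c a"
proof (rule indep3I)
  fix \<alpha> \<beta> \<gamma> assume "\<alpha> \<cdot> b + \<beta> \<cdot> c + \<gamma> \<cdot> a = 0"
  then have "\<gamma> \<cdot> a + \<alpha> \<cdot> b + \<beta> \<cdot> c = 0" by (simp only: ac_simps)
  from indep3D[OF assms this] show "\<alpha> = 0 \<and> \<beta> = 0 \<and> \<gamma> = 0" by blast
qed

lemma indep3_swap:
  assumes "indep3 a b c" shows "indep3 a c b"
proof (rule indep3I)
  fix \<alpha> \<beta> \<gamma> assume "\<alpha> \<cdot> a + \<beta> \<cdot> c + \<gamma> \<cdot> b = 0"
  then have "\<alpha> \<cdot> a + \<gamma> \<cdot> b + \<beta> \<cdot> c = 0" by (simp only: ac_simps)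
  from indep3D[OF assms this] show "\<alpha> = 0 \<and> \<beta> = 0 \<and> \<gamma> = 0" by blast
qed

lemma indep3_permute:
  assumes "indep3 a b c"
  shows "indep3 a c b" "indep3 b a c" "indep3 b c a" "indep3 c a b" "indep3 c b a"
  using assms indep3_rotate indep3_swap by blast+

lemma indep3_scale:
  assumes "indep3 a b c" "k \<noteq> 0" shows "indep3 (k \<cdot> a) b c"
  unfolding indep3_def
proof (intro allI impI)
  fix \<alpha> \<beta> \<gamma> assume "\<alpha> \<cdot> (k \<cdot> a) + \<beta> \<cdot> b + \<gamma> \<cdot> c = 0"
  then show "\<alpha> = 0 \<and> \<beta> = 0 \<and> \<gamma> = 0"
    using indep3D[OF assms(1), of "\<alpha> * k" \<beta> \<gamma>] assms(2) by simp
qed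

lemma indep3_add:
  assumes "indep3 a b c" shows "indep3 (a + k \<cdot> b + l \<cdot> c) b c"
  unfolding indep3_def
proof (intro allI impI)
  fix \<alpha> \<beta> \<gamma> assume "\<alpha> \<cdot> (a + k \<cdot> b + l \<cdot> c) + \<beta> \<cdot> b + \<gamma> \<cdot> c = 0"
  then show "\<alpha> = 0 \<and> \<beta> = 0 \<and> \<gamma> = 0"
    using indep3D[OF assms, of "\<alpha>" "\<alpha> * k + \<beta>" "\<alpha> * l + \<gamma>"] by (simp add: algebra_simps)
qed

lemma span_pair: "x \<in> span {b, c} \<longleftrightarrow> (\<exists>k l. x = k \<cdot> b + l \<cdot> c)"
  by (simp add: span_breakdown_eq algebra_simps)

lemma indep3_iff: "indep3 a b c \<longleftrightarrow> a \<notin> span {b, c} \<and> b \<notin> span {c} \<and> c \<noteq> 0"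
proof (intro iffI conjI)
  assume *: "indep3 a b c"
  show "a \<notin> span {b, c}"
  proof
    assume "a \<in> span {b, c}"
    then obtain k l where "a = k \<cdot> b + l \<cdot> c" by (auto simp: span_pair)
    then have "1 \<cdot> a + (- k) \<cdot> b + (- l) \<cdot> c = 0" by simp
    from indep3D(1)[OF * this] show False by simp
  qed
  show "b \<notin> span {c}"
  proof
    assume "b \<in> span {c}"
    then obtain l where "b = l \<cdot> c" by (auto simp: span_singleton)
    then have "0 \<cdot> a + 1 \<cdot> b + (- l) \<cdot> c = 0" by simp
    from indep3D(2)[OF * this] show False by simp
  qed
  show "c \<noteq> 0" using indep3_nonzero[OF *] by blast
next
  assume *: "a \<notin> span {b, c} \<and> b \<notin> span {c} \<and> c \<noteq> 0"
  show "indep3 a b c"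
  proof (rule indep3I)
    fix \<alpha> \<beta> \<gamma> assume eq: "\<alpha> \<cdot> a + \<beta> \<cdot> b + \<gamma> \<cdot> c = 0"
    have "\<alpha> = 0"
    proof (rule ccontr)
      assume "\<alpha> \<noteq> 0"
      moreover have "\<alpha> \<cdot> a = (- \<beta>) \<cdot> b + (- \<gamma>) \<cdot> c" using eq by (simp add: algebra_simps eq_neg_iff_add_eq_0)
      then have "inverse \<alpha> \<cdot> (\<alpha> \<cdot> a) = inverse \<alpha> \<cdot> ((- \<beta>) \<cdot> b + (- \<gamma>) \<cdot> c)" by simp
      ultimately have "a = (inverse \<alpha> * (- \<beta>)) \<cdot> b + (inverse \<alpha> * (- \<gamma>)) \<cdot> c"
        by (simp add: scale_right_diff_distrib)
      then show False using * span_pair by blast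
    qed
    moreover have "\<beta> = 0"
    proof (rule ccontr)
      assume "\<beta> \<noteq> 0"
      moreover have "\<beta> \<cdot> b = (- \<gamma>) \<cdot> c" using eq \<open>\<alpha> = 0\<close> by (simp add: eq_neg_iff_add_eq_0)
      then have "inverse \<beta> \<cdot> (\<beta> \<cdot> b) = inverse \<beta> \<cdot> ((- \<gamma>) \<cdot> c)" by simp
      ultimately have "b = (inverse \<beta> * (- \<gamma>)) \<cdot> c" by simp
      then show False using * span_singleton by (metis rangeI)
    qed
    ultimately show "\<alpha> = 0 \<and> \<beta> = 0 \<and> \<gamma> = 0" using eq * by simp
  qed
qed

lemma dim_UNIV_eq_3: "dim UNIV = 3"
  using ca by (simp add: ca_algebra_def alg_dim_def)

lemma exists_not_in_span:
  assumes "independent S" "card S < 3" shows "\<exists>x. x \<notin> span S"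
  using assms basis_card_eq_dim[of S UNIV] by (force simp: dim_UNIV_eq_3)

lemma indep3_span:
  assumes "indep3 a b c" obtains \<alpha> \<beta> \<gamma> where "x = \<alpha> \<cdot> a + \<beta> \<cdot> b + \<gamma> \<cdot> c"
proof -
  obtain B where B: "independent B" "UNIV \<subseteq> span B" "card B = 3"
    using basis_exists[of UNIV] dim_UNIV_eq_3 by metis
  have "finite B" using B(3) by (metis card.infinite zero_neq_numeral)
  have "x \<in> span {a, b, c}"
  proof (rule ccontr)
    assume x: "x \<notin> span {a, b, c}"
    have c: "c \<noteq> 0" and b: "b \<notin> span {c}" and a: "a \<notin> span {b, c}"
      using assms by (simp_all add: indep3_iff)
    then have notin: "b \<notin> {c}" "a \<notin> {b, c}" "x \<notin> {a, b, c}"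
      using x span_base by metis+
    have "independent {c}" using c by simp
    then have "independent {b, c}" using b notin by (simp add: independent_insert)
    then have "independent {a, b, c}" using a notin by (simp add: independent_insert)
    then have "independent {x, a, b, c}" using x notin by (simp add: independent_insert)
    moreover have "card {x, a, b, c} = 4" using notin by simp
    ultimately show False using independent_span_bound[OF \<open>finite B\<close>] B by fastforce
  qed
  then obtain \<alpha> \<beta> \<gamma> where "x - \<alpha> \<cdot> a - \<beta> \<cdot> b - \<gamma> \<cdot> c = 0" by (auto simp: span_breakdown_eq)
  then show ?thesis by (intro that[of \<alpha> \<beta> \<gamma>]) (simp add: algebra_simps)
qed

lemma indep3_extend2:
  assumes "a \<noteq> 0" "\<And>k. b \<noteq> k \<cdot> a" obtains c where "indep3 a b c"
proof -
  have b: "b \<notin> span {a}" using assms(2) by (auto simp: span_singleton)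
  moreover have "b \<noteq> a" using assms(2)[of 1] by auto
  ultimately have "independent {b, a}" using assms(1) by (simp add: independent_insert)
  then obtain c where "c \<notin> span {b, a}"
    using exists_not_in_span[of "{b, a}"] \<open>b \<noteq> a\<close> by auto
  then have "indep3 c b a" using b assms(1) by (simp add: indep3_iff)
  then show ?thesis using that indep3_rotate indep3_swap by blast
qed

lemma indep3_extend1:
  assumes "a \<noteq> 0" obtains b c where "indep3 a b c"
proof -
  obtain b where "b \<notin> span {a}"
    using exists_not_in_span[of "{a}"] assms by auto
  then have "b \<noteq> k \<cdot> a" for k by (auto simp: span_singleton)
  then show ?thesis using indep3_extend2[OF assms] that by metis
qed

lemma indep3_exists: obtains a b c where "indep3 a b c"
proof -
  obtain a where "a \<notin> span {}" using exists_not_in_span[of "{}"] by (auto simp: independent_empty)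
  then show ?thesis using indep3_extend1[of a] that by auto
qed

lemma dependent4:
  obtains \<alpha> \<beta> \<gamma> \<delta> where "\<alpha> \<cdot> p + \<beta> \<cdot> q + \<gamma> \<cdot> r + \<delta> \<cdot> t = 0" "\<alpha> \<noteq> 0 \<or> \<beta> \<noteq> 0 \<or> \<gamma> \<noteq> 0 \<or> \<delta> \<noteq> 0"
proof (cases "indep3 p q r")
  case True
  then obtain \<alpha> \<beta> \<gamma> where "t = \<alpha> \<cdot> p + \<beta> \<cdot> q + \<gamma> \<cdot> r" by (rule indep3_span)
  then show ?thesis using that[of \<alpha> \<beta> \<gamma> "-1"] by simp
next
  case False
  then show ?thesis using that[of _ _ _ 0] by (auto simp: indep3_def)
qed

text \<open>A basis identifies triples of coordinates with elements of the algebra; the next lemma reads off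
  an isomorphism from the products of the basis elements.\<close>

definition comb :: "'a \<Rightarrow> 'a \<Rightarrow> 'a \<Rightarrow> 'k ^ 3 \<Rightarrow> 'a" where
  "comb a b c v = v$1 \<cdot> a + v$2 \<cdot> b + v$3 \<cdot> c"

lemma isomorphic_modelI:
  assumes ind: "indep3 a b c"
    and "a \<star> a = comb a b c (mprod i (vector [1, 0, 0]) (vector [1, 0, 0]))"
    and "a \<star> b = comb a b c (mprod i (vector [1, 0, 0]) (vector [0, 1, 0]))"
    and "a \<star> c = comb a b c (mprod i (vector [1, 0, 0]) (vector [0, 0, 1]))"
    and "b \<star> b = comb a b c (mprod i (vector [0, 1, 0]) (vector [0, 1, 0]))"
    and "b \<star> c = comb a b c (mprod i (vector [0, 1, 0]) (vector [0, 0, 1]))"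
    and "c \<star> c = comb a b c (mprod i (vector [0, 0, 1]) (vector [0, 0, 1]))"
  shows "isomorphic A (model i)"
proof -
  let ?f = "comb a b c"
  note prods = assms(2-)
  have "Vector_Spaces.linear (*s) (scl A) ?f"
    by unfold_locales (simp_all add: comb_def algebra_simps)
  moreover have "bij ?f"
  proof (rule bijI)
    show "inj ?f"
    proof (rule injI)
      fix u v assume "?f u = ?f v"
      then have "(u$1 - v$1) \<cdot> a + (u$2 - v$2) \<cdot> b + (u$3 - v$3) \<cdot> c = 0"
        by (simp add: comb_def algebra_simps)
      from indep3D[OF ind this] show "u = v" by (simp add: vec_eq_iff forall_3)
    qed
    show "surj ?f"
    proof (rule surjI)
      fix x
      show "?f (SOME v. ?f v = x) = x"
      proof (rule someI_ex)
        obtain \<alpha> \<beta> \<gamma> where "x = \<alpha> \<cdot> a + \<beta> \<cdot> b + \<gamma> \<cdot> c" using ind by (rule indep3_span)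
        then show "\<exists>v. ?f v = x" by (intro exI[of _ "vector [\<alpha>, \<beta>, \<gamma>]"]) (simp add: comb_def)
      qed
    qed
  qed
  moreover have "?f (mprod i u v) = ?f u \<star> ?f v" for u v
  proof -
    have "?f u \<star> ?f v = (u$1 * v$1) \<cdot> (a \<star> a) + (u$1 * v$2 + u$2 * v$1) \<cdot> (a \<star> b)
        + (u$1 * v$3 + u$3 * v$1) \<cdot> (a \<star> c) + (u$2 * v$2) \<cdot> (b \<star> b)
        + (u$2 * v$3 + u$3 * v$2) \<cdot> (b \<star> c) + (u$3 * v$3) \<cdot> (c \<star> c)"
      by (simp add: comb_def bilinear prod.commute algebra_simps)
    also have "\<dots> = ?f (mprod i u v)"
      unfolding prods by (cases i) (simp_all add: comb_def algebra_simps)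
    finally show ?thesis ..
  qed
  ultimately have "isomorphic (model i) A"
    unfolding isomorphic_def by (intro exI[of _ ?f]) simp
  then show ?thesis by (rule isomorphic_sym)
qed

section \<open>Algebras without idempotents\<close>

lemma double_eq_0: assumes "x + x = (0::'a)" shows "x = 0"
proof -
  have "2 \<cdot> x = 0" using assms scale_left_distrib[of 1 1 x] by simp
  then show ?thesis by (simp add: scale_eq_0_iff)
qed

text \<open>The smallest power of \<open>x\<close> that occurs in a linear relation between \<open>x, x\<^sup>2, x\<^sup>3, x\<^sup>4\<close> is a
  combination of higher ones. Unless the relation is \<open>x\<^sup>4 = 0\<close>, this gives \<open>x\<^sup>3 = x\<^sup>3y\<close>
  with \<open>y\<close> a polynomial in \<open>x\<close> without constant term. Then \<open>y\<close> acts as the identity on all multiples of \<open>x\<^sup>3\<close>,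
  hence on \<open>y\<^sup>3\<close>, so that \<open>y\<^sup>3\<close> is idempotent.\<close>

lemma idempotent_multiple_or_nilpotent:
  "x \<star> (x \<star> (x \<star> x)) = 0 \<or> (\<exists>q. x \<star> q \<noteq> 0 \<and> (x \<star> q) \<star> (x \<star> q) = x \<star> q)"
proof (cases "x \<star> (x \<star> (x \<star> x)) = 0")
  case False
  define x2 x3 where "x2 = x \<star> x" and "x3 = x \<star> x2"
  have nz: "x \<star> x3 \<noteq> 0" using False by (simp add: x2_def x3_def)
  have prods: "x \<star> x = x2" "x \<star> x2 = x3" "x2 \<star> x = x3" "x2 \<star> x2 = x \<star> x3"
    by (simp_all add: x2_def x3_def prod.commute prod.left_commute)
  obtain \<alpha> \<beta> \<gamma> \<delta> where rel: "\<alpha> \<cdot> x + \<beta> \<cdot> x2 + \<gamma> \<cdot> x3 + \<delta> \<cdot> (x \<star> x3) = 0"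
    and ne: "\<alpha> \<noteq> 0 \<or> \<beta> \<noteq> 0 \<or> \<gamma> \<noteq> 0 \<or> \<delta> \<noteq> 0" by (rule dependent4)
  have "\<exists>c a1 a2 a3. c \<noteq> 0 \<and> c \<cdot> x3 + x3 \<star> (a1 \<cdot> x + a2 \<cdot> x2 + a3 \<cdot> x3) = 0"
  proof -
    consider "\<alpha> \<noteq> 0" | "\<alpha> = 0" "\<beta> \<noteq> 0" | "\<alpha> = 0" "\<beta> = 0" "\<gamma> \<noteq> 0"
      | "\<alpha> = 0" "\<beta> = 0" "\<gamma> = 0" "\<delta> \<noteq> 0" using ne by blast
    then show ?thesis
    proof cases
      case 1
      have "x2 \<star> (\<alpha> \<cdot> x + \<beta> \<cdot> x2 + \<gamma> \<cdot> x3 + \<delta> \<cdot> (x \<star> x3)) = 0" by (simp add: rel)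
      moreover have "x \<star> (x2 \<star> x3) = x3 \<star> x3" using prod.assoc[of x x2 x3] by (simp add: prods)
      ultimately have "\<alpha> \<cdot> x3 + x3 \<star> (\<beta> \<cdot> x + \<gamma> \<cdot> x2 + \<delta> \<cdot> x3) = 0"
        by (simp add: bilinear prods prod.commute prod.left_commute[of x2] add.assoc)
      then show ?thesis using 1 by blast
    next
      case 2
      have "x \<star> (\<beta> \<cdot> x2 + \<gamma> \<cdot> x3 + \<delta> \<cdot> (x \<star> x3)) = 0" using rel 2 by simp
      moreover have "x \<star> (x \<star> x3) = x2 \<star> x3" by (simp add: x2_def prod.assoc)
      ultimately have "\<beta> \<cdot> x3 + x3 \<star> (\<gamma> \<cdot> x + \<delta> \<cdot> x2 + 0 \<cdot> x3) = 0"
        by (simp add: bilinear prods prod.commute add.assoc)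
      then show ?thesis using 2 by blast
    next
      case 3
      then have "\<gamma> \<cdot> x3 + x3 \<star> (\<delta> \<cdot> x + 0 \<cdot> x2 + 0 \<cdot> x3) = 0"
        using rel by (simp add: bilinear prod.commute)
      then show ?thesis using 3 by blast
    next
      case 4
      then show ?thesis using rel nz by simp
    qed
  qed
  then obtain c a1 a2 a3 where c: "c \<noteq> 0"
    and rel: "c \<cdot> x3 + x3 \<star> (a1 \<cdot> x + a2 \<cdot> x2 + a3 \<cdot> x3) = 0" by blast
  define p q r where "p = - (a1 / c)" and "q = - (a2 / c)" and "r = - (a3 / c)"
  define y where "y = p \<cdot> x + x \<star> (q \<cdot> x + r \<cdot> x2)"
  have "inverse c \<cdot> (c \<cdot> x3 + x3 \<star> (a1 \<cdot> x + a2 \<cdot> x2 + a3 \<cdot> x3)) = 0" by (simp add: rel)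
  then have x3: "x3 \<star> y = x3"
    using c by (simp add: y_def p_def q_def r_def bilinear prods scale_right_distrib
        divide_inverse mult.commute add.assoc eq_neg_iff_add_eq_0 [symmetric])
  \<comment> \<open>As \<open>y\<close> is a multiple of \<open>x\<close>, each factor \<open>x\<close> in \<open>x\<^sup>3\<close> can be exchanged for \<open>y\<close>.\<close>
  have step: "(y \<star> w) \<star> y = y \<star> w" if "(x \<star> w) \<star> y = x \<star> w" for w
  proof -
    have "y \<star> w = p \<cdot> (x \<star> w) + (q \<cdot> x + r \<cdot> x2) \<star> (x \<star> w)"
      by (simp add: y_def bilinear prod.assoc prod.commute prod.left_commute)
    then show ?thesis by (simp only: prod_add_left prod_scale_left prod.assoc[of _ "x \<star> w" y] that)
  qed
  have "(x \<star> (x \<star> x)) \<star> y = x \<star> (x \<star> x)" using x3 by (simp add: x3_def x2_def)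
  then have "(x \<star> (x \<star> y)) \<star> y = x \<star> (x \<star> y)"
    using step[of "x \<star> x"] by (simp add: prod.commute prod.left_commute)
  then have "(x \<star> (y \<star> y)) \<star> y = x \<star> (y \<star> y)"
    using step[of "x \<star> y"] by (simp add: prod.commute prod.left_commute)
  then have e: "(y \<star> (y \<star> y)) \<star> y = y \<star> (y \<star> y)" by (rule step)
  define e where "e = y \<star> (y \<star> y)"
  have ey: "e \<star> y = e" using e by (simp add: e_def)
  have "e \<star> e = ((e \<star> y) \<star> y) \<star> y" by (simp only: e_def prod.assoc)
  then have "e \<star> e = e" by (simp add: ey)
  moreover have "e \<noteq> 0"
  proof
    assume "e = 0"
    have "x3 = ((x3 \<star> y) \<star> y) \<star> y" by (simp add: x3)
    also have "\<dots> = x3 \<star> e" by (simp only: e_def prod.assoc)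
    finally show False using nz \<open>e = 0\<close> by simp
  qed
  moreover have "e = x \<star> (p \<cdot> (y \<star> y) + (q \<cdot> x + r \<cdot> x2) \<star> (y \<star> y))"
    unfolding e_def by (subst (1) y_def) (simp add: bilinear prod.assoc)
  ultimately show ?thesis by metis
qed blast

lemma indep3_powers:
  assumes "x \<star> (x \<star> (x \<star> x)) = 0" "x \<star> (x \<star> x) \<noteq> 0"
  shows "indep3 x (x \<star> x) (x \<star> (x \<star> x))"
proof (rule indep3I)
  fix \<alpha> \<beta> \<gamma> assume eq: "\<alpha> \<cdot> x + \<beta> \<cdot> (x \<star> x) + \<gamma> \<cdot> (x \<star> (x \<star> x)) = 0"
  have "x \<star> (x \<star> (\<alpha> \<cdot> x + \<beta> \<cdot> (x \<star> x) + \<gamma> \<cdot> (x \<star> (x \<star> x)))) = 0" by (simp add: eq)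
  then have \<alpha>: "\<alpha> = 0" using assms by (simp add: bilinear)
  have "x \<star> (\<alpha> \<cdot> x + \<beta> \<cdot> (x \<star> x) + \<gamma> \<cdot> (x \<star> (x \<star> x))) = 0" by (simp add: eq)
  then have "\<beta> = 0" using assms \<alpha> by (simp add: bilinear)
  then show "\<alpha> = 0 \<and> \<beta> = 0 \<and> \<gamma> = 0" using eq \<alpha> assms by simp
qed

text \<open>Polarisation: \<open>(x + y)\<^sup>3\<close> and \<open>(x - y)\<^sup>3\<close> give \<open>6xy\<^sup>2 = 0\<close>, and \<open>x(y + z)\<^sup>2\<close> then gives
  \<open>2xyz = 0\<close>.\<close>

lemma triple_product_eq_0:
  assumes "\<And>x. x \<star> (x \<star> x) = 0" shows "x \<star> (y \<star> z) = 0"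
proof -
  have sq: "x \<star> (y \<star> y) = 0" for x y
  proof -
    define u v where "u = x \<star> (x \<star> y)" and "v = x \<star> (y \<star> y)"
    have "(x + y) \<star> ((x + y) \<star> (x + y)) = (u + v) + (u + v) + (u + v)"
      by (simp add: bilinear assms u_def v_def ac_simps)
    then have 1: "(u + v) + (u + v) + (u + v) = 0" by (simp add: assms)
    have "(x - y) \<star> ((x - y) \<star> (x - y)) = (v - u) + (v - u) + (v - u)"
      by (simp add: bilinear assms u_def v_def prod.commute prod.left_commute algebra_simps)
    then have 2: "(v - u) + (v - u) + (v - u) = 0" by (simp add: assms)
    have "6 \<cdot> v = 3 \<cdot> (u + v) + 3 \<cdot> (v - u)"
      by (simp add: algebra_simps flip: scale_left_distrib)
    moreover have "3 \<cdot> w = w + w + w" for w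
      using scale_left_distrib[of 2 1 w] scale_left_distrib[of 1 1 w] by simp
    ultimately have "6 \<cdot> v = 0" using 1 2 by simp
    then show ?thesis by (simp add: v_def scale_eq_0_iff)
  qed
  have "x \<star> ((y + z) \<star> (y + z)) = x \<star> (y \<star> z) + x \<star> (y \<star> z)"
    by (simp add: bilinear sq prod.commute)
  then show ?thesis using sq double_eq_0 by metis
qed

lemma product_eq_0:
  assumes "\<And>x. x \<star> x = 0" shows "x \<star> y = 0"
proof -
  have "x \<star> y + x \<star> y = 0"
    using assms[of "x + y"] by (simp add: bilinear assms[of x] assms[of y] prod.commute)
  then show ?thesis by (rule double_eq_0)
qed

text \<open>If all triple products vanish and \<open>p = x\<^sup>2 \<noteq> 0\<close>, a vector \<open>w\<close> outside the span of \<open>x\<close> and \<open>p\<close> can be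
  made orthogonal to \<open>x\<close>. Then \<open>w\<^sup>2 = cp\<close>, and \<open>w\<close> can be rescaled so that \<open>c\<close> is \<open>0\<close>, \<open>1\<close> or \<open>-1\<close>.\<close>

lemma classification_nil:
  assumes nil: "\<And>x. x \<star> (x \<star> (x \<star> x)) = 0"
  shows "\<exists>i. isomorphic A (model i)"
proof -
  consider x where "x \<star> (x \<star> x) \<noteq> 0"
    | "\<And>x. x \<star> x = 0" | x where "\<And>x. x \<star> (x \<star> x) = 0" "x \<star> x \<noteq> 0" by blast
  then show ?thesis
  proof cases
    case (1 x)
    have "isomorphic A (model L_A33)"
      by (rule isomorphic_modelI[OF indep3_powers[OF nil 1]])
        (simp_all add: comb_def prod.assoc nil)
    then show ?thesis ..
  next
    case 2
    obtain a b c where "indep3 a b c" by (rule indep3_exists)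
    then have "isomorphic A (model L_A31)"
      by (rule isomorphic_modelI) (simp_all add: comb_def product_eq_0[OF 2])
    then show ?thesis ..
  next
    case (3 x)
    define p where "p = x \<star> x"
    have p: "p \<noteq> 0" and xx: "x \<star> x = p" using 3 by (simp_all add: p_def)
    have trip: "y \<star> (z \<star> t) = 0" for y z t by (rule triple_product_eq_0[OF 3(1)])
    have ann: "y \<star> p = 0" "p \<star> y = 0" for y using trip by (simp_all add: p_def prod.commute)
    have "x \<noteq> 0" using p xx by auto
    moreover have "p \<noteq> k \<cdot> x" for k
    proof
      assume "p = k \<cdot> x"
      then have "k \<cdot> p = 0" using ann(1)[of x] xx by (simp add: bilinear)
      then show False using p \<open>p = k \<cdot> x\<close> by auto
    qed
    ultimately obtain w where ind: "indep3 x p w" by (rule indep3_extend2)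
    obtain a b c where xw: "x \<star> w = a \<cdot> x + b \<cdot> p + c \<cdot> w" using ind by (rule indep3_span)
    have "x \<star> (a \<cdot> x + b \<cdot> p + c \<cdot> w) = 0" unfolding xw[symmetric] by (rule trip)
    then have "(c * a) \<cdot> x + (a + c * b) \<cdot> p + (c * c) \<cdot> w = 0"
      by (simp add: bilinear xx ann xw algebra_simps)
    from indep3D[OF ind this] have "c = 0" "a = 0" by simp_all
    \<comment> \<open>Now \<open>x \<star> w = b \<cdot> p\<close>, and subtracting \<open>b \<cdot> x\<close> makes the product with \<open>x\<close> vanish.\<close>
    define w' where "w' = w - b \<cdot> x"
    have "x \<star> w' = 0" by (simp add: w'_def bilinear xw xx \<open>c = 0\<close> \<open>a = 0\<close>)
    have "indep3 (w + (- b) \<cdot> x + 0 \<cdot> p) x p"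
      by (rule indep3_add[OF indep3_permute(4)[OF ind]])
    then have "indep3 w' x p" by (simp add: w'_def)
    then have ind: "indep3 x w' p" by (rule indep3_permute)
    obtain a b c where ww: "w' \<star> w' = a \<cdot> x + b \<cdot> w' + c \<cdot> p" using ind by (rule indep3_span)
    have "x \<star> (a \<cdot> x + b \<cdot> w' + c \<cdot> p) = 0" unfolding ww[symmetric] by (rule trip)
    then have "a = 0" using p by (simp add: bilinear xx ann \<open>x \<star> w' = 0\<close>)
    have "w' \<star> (a \<cdot> x + b \<cdot> w' + c \<cdot> p) = 0" unfolding ww[symmetric] by (rule trip)
    then have "0 \<cdot> x + (b * b) \<cdot> w' + (b * c) \<cdot> p = 0"
      by (simp add: bilinear ann ww \<open>a = 0\<close> scale_right_distrib)
    from indep3D[OF ind this] have "b = 0" by simp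
    have ww: "w' \<star> w' = c \<cdot> p" using ww \<open>a = 0\<close> \<open>b = 0\<close> by simp
    note facts = ww ann xx \<open>x \<star> w' = 0\<close> \<open>x \<star> w' = 0\<close>[unfolded prod.commute[of x]]
    obtain s where s: "s * s = c \<or> s * s = - c" using square by blast
    show ?thesis
    proof (cases "c = 0")
      case True
      have "isomorphic A (model L_A32)"
        by (rule isomorphic_modelI[OF indep3_swap[OF ind]]) (simp_all add: comb_def facts True)
      then show ?thesis ..
    next
      case False
      then have "s \<noteq> 0" using s by auto
      define u where "u = inverse s \<cdot> w'"
      have ind': "indep3 u x p"
        unfolding u_def using \<open>s \<noteq> 0\<close> by (intro indep3_scale indep3_permute(2)[OF ind]) simp
      have xu: "x \<star> u = 0" "u \<star> x = 0" by (simp_all add: u_def bilinear facts)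
      have uu: "u \<star> u = (inverse (s * s) * c) \<cdot> p" by (simp add: u_def bilinear facts mult.assoc)
      from s show ?thesis
      proof
        assume "s * s = c"
        then have "u \<star> u = p" using uu False by simp
        then have "isomorphic A (model L_A34)"
          by (intro isomorphic_modelI[OF ind']) (simp_all add: comb_def facts xu)
        then show ?thesis ..
      next
        assume "s * s = - c"
        then have "u \<star> u = - p" using uu False by simp
        then have "isomorphic A (model L_A35)"
          by (intro isomorphic_modelI[OF ind']) (simp_all add: comb_def facts xu)
        then show ?thesis ..
      qed
    qed
  qed
qed

section \<open>Idempotents\<close>

text \<open>Decomposition by the eigenvalues \<open>0\<close> and \<open>1\<close> of multiplication by \<open>e\<close>, in a basis that starts
  with \<open>e\<close>. The three cases are those in which \<open>eA\<close> has dimension \<open>1\<close>, \<open>2\<close> and \<open>3\<close>.\<close>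

lemma peirce:
  assumes e: "e \<star> e = e" "e \<noteq> 0"
  obtains v w where "indep3 e v w" "e \<star> v = 0" "e \<star> w = 0"
  | v w where "indep3 e v w" "e \<star> v = v" "e \<star> w = 0"
  | "\<And>x. e \<star> x = x"
proof (cases "\<forall>x. \<exists>k. e \<star> x = k \<cdot> e")
  case True
  obtain v w where ind: "indep3 e v w" using indep3_extend1[OF e(2)] .
  obtain k l where kl: "e \<star> v = k \<cdot> e" "e \<star> w = l \<cdot> e" using True by blast
  have "indep3 (v + (- k) \<cdot> e + 0 \<cdot> w) e w" by (rule indep3_add[OF indep3_permute(2)[OF ind]])
  then have "indep3 (v - k \<cdot> e) e w" by simp
  from indep3_add[OF indep3_permute(5)[OF this], of "- l" 0]
  have "indep3 (w - l \<cdot> e) e (v - k \<cdot> e)" by simp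
  then have "indep3 e (v - k \<cdot> e) (w - l \<cdot> e)" by (rule indep3_permute)
  then show ?thesis by (rule that(1)) (simp_all add: bilinear kl e)
next
  case False
  then obtain x where x: "\<And>k. e \<star> x \<noteq> k \<cdot> e" by blast
  define u where "u = e \<star> x"
  have eu: "e \<star> u = u" using prod.assoc[of e e x] by (simp add: u_def e)
  obtain w where ind: "indep3 e u w" using indep3_extend2[OF e(2)] x u_def by metis
  obtain \<alpha> \<beta> \<gamma> where ew: "e \<star> w = \<alpha> \<cdot> e + \<beta> \<cdot> u + \<gamma> \<cdot> w" using ind by (rule indep3_span)
  have "e \<star> (e \<star> w) = e \<star> w" using prod.assoc[of e e w] e by simp
  then have "e \<star> (\<alpha> \<cdot> e + \<beta> \<cdot> u + \<gamma> \<cdot> w) - e \<star> w = 0" by (simp add: ew)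
  then have "(\<gamma> * \<alpha>) \<cdot> e + (\<gamma> * \<beta>) \<cdot> u + (\<gamma> * \<gamma> - \<gamma>) \<cdot> w = 0"
    by (simp add: bilinear e eu ew algebra_simps)
  from indep3D[OF ind this] have \<gamma>: "\<gamma> * \<alpha> = 0" "\<gamma> * \<beta> = 0" "\<gamma> = 0 \<or> \<gamma> = 1"
    by (auto simp: algebra_simps)
  show ?thesis
  proof (cases "\<gamma> = 0")
    case True
    have "indep3 (w + (- \<alpha>) \<cdot> e + (- \<beta>) \<cdot> u) e u"
      by (rule indep3_add[OF indep3_permute(4)[OF ind]])
    then have "indep3 (w - \<alpha> \<cdot> e - \<beta> \<cdot> u) e u" by simp
    then have "indep3 e u (w - \<alpha> \<cdot> e - \<beta> \<cdot> u)" by (rule indep3_permute)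
    then show ?thesis by (rule that(2)) (simp_all add: bilinear e eu ew True)
  next
    case False
    then have ew: "e \<star> w = w" using \<gamma> ew by auto
    have "e \<star> x = x" for x
    proof -
      obtain a b c where "x = a \<cdot> e + b \<cdot> u + c \<cdot> w" using ind by (rule indep3_span)
      then show ?thesis by (simp add: bilinear e eu ew)
    qed
    then show ?thesis by (rule that(3))
  qed
qed

text \<open>The ideal \<open>eA\<close> is a two-dimensional algebra with identity, hence the dual numbers, two copies of
  the field, or the field with a square root of \<open>-1\<close> adjoined, according to the discriminant of a second
  basis vector.\<close>

lemma classification_rank_two_idempotent:
  assumes ind: "indep3 e u w" and e: "e \<star> e = e" "e \<star> u = u" "e \<star> w = 0"
  shows "\<exists>i. isomorphic A (model i)"
proof -
  obtain \<alpha> \<beta> \<gamma> where uu: "u \<star> u = \<alpha> \<cdot> e + \<beta> \<cdot> u + \<gamma> \<cdot> w" using ind by (rule indep3_span)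
  have "e \<star> (u \<star> u) = u \<star> u" using prod.assoc[of e u u] e by simp
  then have "e \<star> (\<alpha> \<cdot> e + \<beta> \<cdot> u + \<gamma> \<cdot> w) - u \<star> u = 0" by (simp add: uu)
  then have "0 \<cdot> e + 0 \<cdot> u + \<gamma> \<cdot> w = 0" by (simp add: bilinear e uu)
  from indep3D[OF ind this] have "\<gamma> = 0" by simp
  obtain \<kappa> \<mu> c where ww: "w \<star> w = \<kappa> \<cdot> e + \<mu> \<cdot> u + c \<cdot> w" using ind by (rule indep3_span)
  have "e \<star> (w \<star> w) = 0" using prod.assoc[of e w w] e by simp
  then have "\<kappa> \<cdot> e + \<mu> \<cdot> u + 0 \<cdot> w = 0" by (simp add: bilinear e ww)
  from indep3D[OF ind this] have "w \<star> w = c \<cdot> w" using ww by simp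
  have uw: "u \<star> w = 0" using prod.assoc[of u e w] e by (simp add: prod.commute)
  \<comment> \<open>The ideal spanned by \<open>w\<close> has the zero product or is a copy of the field.\<close>
  obtain w' where indw: "indep3 e u w'" and ew: "e \<star> w' = 0" "u \<star> w' = 0"
    and ww: "w' \<star> w' = 0 \<or> w' \<star> w' = w'"
  proof (cases "c = 0")
    case True
    then show ?thesis using that[of w] ind e uw \<open>w \<star> w = c \<cdot> w\<close> by simp
  next
    case False
    have "indep3 (inverse c \<cdot> w) e u"
      using False by (intro indep3_scale indep3_permute(4)[OF ind]) simp
    then have "indep3 e u (inverse c \<cdot> w)" by (rule indep3_permute)
    then show ?thesis
      using False by (intro that[of "inverse c \<cdot> w"])
        (simp_all add: bilinear e uw \<open>w \<star> w = c \<cdot> w\<close>)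
  qed
  \<comment> \<open>Completing the square in \<open>u\<^sup>2 = \<alpha>e + \<beta>u\<close>.\<close>
  define h where "h = \<beta> / 2"
  define v where "v = u - h \<cdot> e"
  have "indep3 (u + (- h) \<cdot> e + 0 \<cdot> w') e w'"
    by (rule indep3_add[OF indep3_permute(2)[OF indw]])
  then have indv: "indep3 v e w'" by (simp add: v_def)
  have ev: "e \<star> v = v" and vw: "v \<star> w' = 0" by (simp_all add: v_def bilinear e ew)
  define b where "b = \<alpha> + h * h"
  have "\<beta> = h + h" by (simp add: h_def)
  then have "u \<star> u = \<alpha> \<cdot> e + (h \<cdot> u + h \<cdot> u)"
    using uu \<open>\<gamma> = 0\<close> by (simp only: scale_left_distrib) simp
  then have vv: "v \<star> v = b \<cdot> e"
    by (simp add: v_def b_def bilinear e e(2)[unfolded prod.commute[of e]] algebra_simps)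
  note facts = e(1) ev vw ew vv ev[unfolded prod.commute[of e]] ew[unfolded prod.commute[of _ w']]
    vw[unfolded prod.commute[of _ w']]
  obtain s where s: "s * s = b \<or> s * s = - b" using square by blast
  consider "b = 0" | "b \<noteq> 0" "s * s = b" | "b \<noteq> 0" "s * s = - b" using s by blast
  then show ?thesis
  proof cases
    case 1
    from ww show ?thesis
    proof
      assume "w' \<star> w' = 0"
      then have "isomorphic A (model L_A1u_A1)"
        by (intro isomorphic_modelI[OF indv]) (simp_all add: comb_def facts 1)
      then show ?thesis ..
    next
      assume "w' \<star> w' = w'"
      then have "isomorphic A (model L_A1u_A0u)"
        by (intro isomorphic_modelI[OF indv]) (simp_all add: comb_def facts 1)
      then show ?thesis ..
    qed
  next
    case 2
    then have s: "s \<noteq> 0" by auto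
    define j where "j = inverse s \<cdot> v"
    have "indep3 j e w'" unfolding j_def using s by (intro indep3_scale indv) simp
    have "inverse s * (inverse s * b) = 1" unfolding 2(2)[symmetric] using s by (simp add: field_simps)
    then have jj: "j \<star> j = e" by (simp add: j_def bilinear facts)
    have j: "e \<star> j = j" "j \<star> e = j" "j \<star> w' = 0" "w' \<star> j = 0" by (simp_all add: j_def bilinear facts)
    \<comment> \<open>The orthogonal idempotents of two copies of the field, where \<open>j = (1, -1)\<close>.\<close>
    define p q where "p = (1 / 2) \<cdot> (e + j)" and "q = (1 / 2) \<cdot> (e - j)"
    have half: "(1 / 2) \<cdot> (x + x) = x" for x
      using scale_left_distrib[of "1 / 2" "1 / 2" x] by (simp add: scale_right_distrib)
    have "p \<star> p = (1 / 2) \<cdot> ((1 / 2) \<cdot> ((e + j) + (e + j)))"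
      "q \<star> q = (1 / 2) \<cdot> ((1 / 2) \<cdot> ((e - j) + (e - j)))"
      by (simp_all add: p_def q_def bilinear facts j jj algebra_simps)
    then have pq: "p \<star> p = p" "q \<star> q = q" "p \<star> q = 0" "p \<star> w' = 0" "q \<star> w' = 0"
      by (simp_all only: half) (simp_all add: p_def q_def bilinear facts j jj)
    have ind: "indep3 p q w'"
    proof (rule indep3I)
      fix x y z assume "x \<cdot> p + y \<cdot> q + z \<cdot> w' = 0"
      then have "((x - y) / 2) \<cdot> j + ((x + y) / 2) \<cdot> e + z \<cdot> w' = 0"
        by (simp add: p_def q_def algebra_simps add_divide_distrib diff_divide_distrib)
      from indep3D[OF \<open>indep3 j e w'\<close> this] have "x = y" "x + y = 0" "z = 0" by simp_all
      then show "x = 0 \<and> y = 0 \<and> z = 0" by (auto simp flip: mult_2)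
    qed
    from ww show ?thesis
    proof
      assume "w' \<star> w' = 0"
      then have "isomorphic A (model L_A0u_A0u_A1)"
        by (intro isomorphic_modelI[OF ind]) (simp_all add: comb_def pq)
      then show ?thesis ..
    next
      assume "w' \<star> w' = w'"
      then have "isomorphic A (model L_A0u_A0u_A0u)"
        by (intro isomorphic_modelI[OF ind]) (simp_all add: comb_def pq)
      then show ?thesis ..
    qed
  next
    case 3
    then have s: "s \<noteq> 0" by auto
    define j where "j = inverse s \<cdot> v"
    have "indep3 j e w'" unfolding j_def using s by (intro indep3_scale indv) simp
    then have ind: "indep3 e j w'" by (rule indep3_permute)
    have "inverse s * (inverse s * b) = -1" using 3 s by (simp add: field_simps)
    then have jj: "j \<star> j = - e" by (simp add: j_def bilinear facts)
    have j: "e \<star> j = j" "j \<star> e = j" "j \<star> w' = 0" "w' \<star> j = 0" by (simp_all add: j_def bilinear facts)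
    from ww show ?thesis
    proof
      assume "w' \<star> w' = 0"
      then have "isomorphic A (model L_C_A1)"
        by (intro isomorphic_modelI[OF ind]) (simp_all add: comb_def facts j jj)
      then show ?thesis ..
    next
      assume "w' \<star> w' = w'"
      then have "isomorphic A (model L_C_A0u)"
        by (intro isomorphic_modelI[OF ind]) (simp_all add: comb_def facts j jj)
      then show ?thesis ..
    qed
  qed
qed

text \<open>A subalgebra of dimension \<open>2\<close> has no room for three independent powers, so \<open>x\<^sup>3 = 0\<close> in it. Either
  all squares vanish, and with them all products, or \<open>x, x\<^sup>2\<close> is a basis. The vector \<open>e\<close> only
  completes the basis of the plane \<open>S\<close> to one of the whole algebra.\<close>

lemma nil_plane_basis:
  assumes ind: "indep3 e v w"
    and S: "\<And>x. x \<in> S \<longleftrightarrow> (\<exists>\<beta> \<gamma>. x = \<beta> \<cdot> v + \<gamma> \<cdot> w)"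
    and closed: "\<And>x y. x \<in> S \<Longrightarrow> y \<in> S \<Longrightarrow> x \<star> y \<in> S"
    and nil: "\<And>x. x \<in> S \<Longrightarrow> x \<star> (x \<star> (x \<star> x)) = 0"
  obtains a b where "a \<in> S" "b \<in> S" "indep3 e a b" "a \<star> b = 0" "b \<star> b = 0"
    "a \<star> a = 0 \<or> a \<star> a = b"
proof -
  have "v = 1 \<cdot> v + 0 \<cdot> w" "w = 0 \<cdot> v + 1 \<cdot> w" "v + w = 1 \<cdot> v + 1 \<cdot> w" by simp_all
  then have vw: "v \<in> S" "w \<in> S" "v + w \<in> S" unfolding S by blast+
  have lin: "\<beta> \<cdot> x + \<gamma> \<cdot> y \<in> S" if xy: "x \<in> S" "y \<in> S" for \<beta> \<gamma> x y
  proof -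
    obtain a b c d where "x = a \<cdot> v + b \<cdot> w" "y = c \<cdot> v + d \<cdot> w" using xy S by blast
    then have "\<beta> \<cdot> x + \<gamma> \<cdot> y = (\<beta> * a + \<gamma> * c) \<cdot> v + (\<beta> * b + \<gamma> * d) \<cdot> w"
      by (simp add: algebra_simps)
    then show ?thesis unfolding S by blast
  qed
  have e: "k = 0" if "k \<cdot> e \<in> S" for k
  proof -
    obtain \<beta> \<gamma> where "k \<cdot> e = \<beta> \<cdot> v + \<gamma> \<cdot> w" using \<open>k \<cdot> e \<in> S\<close> S by blast
    then have "k \<cdot> e + (- \<beta>) \<cdot> v + (- \<gamma>) \<cdot> w = 0" by simp
    from indep3D[OF ind this] show "k = 0" by simp
  qed
  show ?thesis
  proof (cases "\<forall>x\<in>S. x \<star> x = 0")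
    case True
    then have sq: "v \<star> v = 0" "w \<star> w = 0" "(v + w) \<star> (v + w) = 0" using vw by auto
    then have "v \<star> w + v \<star> w = 0" by (simp add: bilinear prod.commute)
    then have "v \<star> w = 0" by (rule double_eq_0)
    then show ?thesis using that[of v w] sq vw ind by blast
  next
    case False
    then obtain x where x: "x \<in> S" "x \<star> x \<noteq> 0" by blast
    have xx: "x \<star> x \<in> S" "x \<star> (x \<star> x) \<in> S" using x closed by blast+
    have x3: "x \<star> (x \<star> x) = 0"
    proof (rule ccontr)
      assume "x \<star> (x \<star> x) \<noteq> 0"
      then obtain \<alpha> \<beta> \<gamma> where "e = \<alpha> \<cdot> x + \<beta> \<cdot> (x \<star> x) + \<gamma> \<cdot> (x \<star> (x \<star> x))"
        using indep3_span[OF indep3_powers[OF nil[OF x(1)]]] by blast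
      moreover have "1 \<cdot> (\<alpha> \<cdot> x + \<beta> \<cdot> (x \<star> x)) + \<gamma> \<cdot> (x \<star> (x \<star> x)) \<in> S"
        by (intro lin x xx)
      ultimately have "1 \<cdot> e \<in> S" by simp
      then show False using e by fastforce
    qed
    have "indep3 e x (x \<star> x)"
    proof (rule indep3I)
      fix \<alpha> \<beta> \<gamma> assume eq: "\<alpha> \<cdot> e + \<beta> \<cdot> x + \<gamma> \<cdot> (x \<star> x) = 0"
      then have "\<alpha> \<cdot> e = (- \<beta>) \<cdot> x + (- \<gamma>) \<cdot> (x \<star> x)"
        by (simp add: algebra_simps eq_neg_iff_add_eq_0)
      moreover have "(- \<beta>) \<cdot> x + (- \<gamma>) \<cdot> (x \<star> x) \<in> S" by (intro lin x xx)
      ultimately have \<alpha>: "\<alpha> = 0" using e by metis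
      have "x \<star> (\<alpha> \<cdot> e + \<beta> \<cdot> x + \<gamma> \<cdot> (x \<star> x)) = 0" by (simp add: eq)
      then have "\<beta> = 0" using \<alpha> x x3 by (simp add: bilinear)
      then show "\<alpha> = 0 \<and> \<beta> = 0 \<and> \<gamma> = 0" using eq \<alpha> x by simp
    qed
    moreover have "(x \<star> x) \<star> (x \<star> x) = 0" using nil[OF x(1)] by (simp add: prod.assoc)
    ultimately show ?thesis using that[of x "x \<star> x"] x xx x3 by blast
  qed
qed

text \<open>The characteristic polynomial of multiplication by \<open>x\<close> is a cubic.\<close>

lemma eigenvector: obtains t z where "z \<noteq> 0" "x \<star> z = t \<cdot> z"
proof -
  obtain a b c where ind: "indep3 a b c" by (rule indep3_exists)
  obtain a1 a2 a3 where a: "x \<star> a = a1 \<cdot> a + a2 \<cdot> b + a3 \<cdot> c" using ind by (rule indep3_span)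
  obtain b1 b2 b3 where b: "x \<star> b = b1 \<cdot> a + b2 \<cdot> b + b3 \<cdot> c" using ind by (rule indep3_span)
  obtain c1 c2 c3 where c: "x \<star> c = c1 \<cdot> a + c2 \<cdot> b + c3 \<cdot> c" using ind by (rule indep3_span)
  define N :: "'k \<Rightarrow> 'k ^ 3 ^ 3" where
    "N t = vector [vector [a1 - t, b1, c1], vector [a2, b2 - t, c2], vector [a3, b3, c3 - t]]" for t
  define p where "p = - (a1 + b2 + c3)"
  define q where "q = a1 * b2 + a1 * c3 + b2 * c3 - a2 * b1 - a3 * c1 - b3 * c2"
  define r where "r = - (a1 * (b2 * c3 - b3 * c2) - b1 * (a2 * c3 - a3 * c2) + c1 * (a2 * b3 - a3 * b2))"
  obtain t where t: "t ^ 3 + p * t ^ 2 + q * t + r = 0" using cubic by blast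
  have "det (N t) = - (t ^ 3 + p * t ^ 2 + q * t + r)"
    by (simp add: N_def det_3 p_def q_def r_def power2_eq_square power3_eq_cube algebra_simps)
  then have "\<not> invertible (N t)" using t by (simp add: invertible_det_nz)
  then have "\<not> (\<exists>B. B ** N t = mat 1)" by (simp only: invertible_left_inverse) simp
  then obtain v where v: "N t *v v = 0" "v \<noteq> 0"
    unfolding matrix_left_invertible_ker by blast
  define z where "z = v$1 \<cdot> a + v$2 \<cdot> b + v$3 \<cdot> c"
  have "v$1 \<noteq> 0 \<or> v$2 \<noteq> 0 \<or> v$3 \<noteq> 0" using v(2) by (simp add: vec_eq_iff forall_3)
  then have "z \<noteq> 0" using indep3D[OF ind] z_def by metis
  moreover have "x \<star> z = t \<cdot> z"
  proof -
    have "(a1 - t) * v$1 + b1 * v$2 + c1 * v$3 = 0" "a2 * v$1 + (b2 - t) * v$2 + c2 * v$3 = 0"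
      "a3 * v$1 + b3 * v$2 + (c3 - t) * v$3 = 0"
      using v(1) by (simp_all add: N_def vec_eq_iff forall_3 matrix_vector_mult_def sum_3)
    then have eqs: "t * v$1 = a1 * v$1 + b1 * v$2 + c1 * v$3"
      "t * v$2 = a2 * v$1 + b2 * v$2 + c2 * v$3" "t * v$3 = a3 * v$1 + b3 * v$2 + c3 * v$3"
      by (simp_all add: algebra_simps)
    show ?thesis
      unfolding z_def by (simp only: scale_right_distrib scale_scale eqs)
        (simp add: bilinear a b c algebra_simps)
  qed
  ultimately show ?thesis by (rule that)
qed

text \<open>The annihilator of \<open>e\<close> consists of nilpotent elements: an idempotent \<open>f\<close> in it would make
  \<open>e + f\<close> an idempotent whose ideal contains both \<open>e\<close> and \<open>f\<close>.\<close>

lemma classification_rank_one_idempotents: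
  assumes rank1: "\<And>f x. f \<star> f = f \<Longrightarrow> f \<noteq> 0 \<Longrightarrow> \<exists>k. f \<star> x = k \<cdot> f"
    and e: "e \<star> e = e" "e \<noteq> 0"
  shows "\<exists>i. isomorphic A (model i)"
proof -
  have no_fix: "\<not> indep3 e v w" if fix_v: "e \<star> v = v" for v w
  proof
    assume ind: "indep3 e v w"
    obtain k where "v = k \<cdot> e" using rank1[OF e, of v] fix_v by auto
    then have "(- k) \<cdot> e + 1 \<cdot> v + 0 \<cdot> w = 0" by simp
    from indep3D(2)[OF ind this] show False by simp
  qed
  obtain v w where ind: "indep3 e v w" and ev: "e \<star> v = 0" "e \<star> w = 0"
    using e no_fix indep3_extend1[OF e(2)] by (metis peirce)
  define S where "S = {x. e \<star> x = 0}"
  have S: "x \<in> S \<longleftrightarrow> (\<exists>\<beta> \<gamma>. x = \<beta> \<cdot> v + \<gamma> \<cdot> w)" for x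
  proof
    assume "x \<in> S"
    obtain \<alpha> \<beta> \<gamma> where x: "x = \<alpha> \<cdot> e + \<beta> \<cdot> v + \<gamma> \<cdot> w" using ind by (rule indep3_span)
    then have "\<alpha> = 0" using \<open>x \<in> S\<close> e by (simp add: S_def bilinear ev)
    then show "\<exists>\<beta> \<gamma>. x = \<beta> \<cdot> v + \<gamma> \<cdot> w" using x by auto
  qed (auto simp: S_def bilinear ev)
  have closed: "x \<star> y \<in> S" if "x \<in> S" "y \<in> S" for x y
    using that by (simp add: S_def flip: prod.assoc)
  have nil: "x \<star> (x \<star> (x \<star> x)) = 0" if "x \<in> S" for x
  proof (rule ccontr)
    assume "x \<star> (x \<star> (x \<star> x)) \<noteq> 0"
    then obtain q where q: "x \<star> q \<noteq> 0" "(x \<star> q) \<star> (x \<star> q) = x \<star> q"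
      using idempotent_multiple_or_nilpotent by blast
    define f where "f = x \<star> q"
    have f: "f \<noteq> 0" "f \<star> f = f" "e \<star> f = 0" "f \<star> e = 0"
      using q that by (simp_all add: f_def S_def prod.commute[of _ e] flip: prod.assoc)
    have "(e + f) \<star> (e + f) = e + f" by (simp add: bilinear e f)
    moreover have "e + f \<noteq> 0"
    proof
      assume "e + f = 0"
      then have "e \<star> (e + f) = 0" by simp
      then show False by (simp add: bilinear e f)
    qed
    ultimately obtain k where "(e + f) \<star> e = k \<cdot> (e + f)" using rank1 by blast
    then have k: "e = k \<cdot> (e + f)" by (simp add: bilinear e f)
    then have "f \<star> e = f \<star> (k \<cdot> (e + f))" by simp
    then have "k = 0" using f by (simp add: bilinear scale_eq_0_iff)
    then show False using k e by simp
  qed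
  obtain a b where ab: "a \<in> S" "b \<in> S" "a \<star> b = 0" "b \<star> b = 0" "a \<star> a = 0 \<or> a \<star> a = b"
    and ind: "indep3 e a b"
    using nil_plane_basis[OF ind S closed nil] by metis
  have ea: "e \<star> a = 0" "e \<star> b = 0" using ab by (simp_all add: S_def)
  then have ae: "a \<star> e = 0" "b \<star> e = 0" by (simp_all add: prod.commute)
  from ab(5) show ?thesis
  proof
    assume "a \<star> a = 0"
    then have "isomorphic A (model L_A0u_A1_A1)"
      by (intro isomorphic_modelI[OF ind]) (simp_all add: comb_def e ab ea)
    then show ?thesis ..
  next
    assume "a \<star> a = b"
    then have "isomorphic A (model L_A22_A0u)"
      by (intro isomorphic_modelI[OF indep3_permute(3)[OF ind]]) (simp_all add: comb_def e ab ae)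
    then show ?thesis ..
  qed
qed

text \<open>A zero divisor has no multiple equal to \<open>e\<close>, hence no nonzero idempotent multiple, so it is
  nilpotent. Subtracting eigenvalues from two
  basis vectors gives zero divisors \<open>m, n\<close>, which span a plane. That this plane is closed
  under products and nilpotent becomes evident from a single vector \<open>z\<close> that both annihilate, since
  the plane is then the annihilator of \<open>z\<close>.\<close>

lemma classification_local:
  assumes e: "\<And>x. e \<star> x = x" and idem: "\<And>f. f \<star> f = f \<Longrightarrow> f = 0 \<or> f = e"
  shows "\<exists>i. isomorphic A (model i)"
proof -
  have e': "x \<star> e = x" for x using e prod.commute by metis
  have singular: "x \<star> (x \<star> (x \<star> x)) = 0" if "x \<star> z = 0" "z \<noteq> 0" for x z
  proof (rule ccontr)
    assume "x \<star> (x \<star> (x \<star> x)) \<noteq> 0"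
    then obtain q where "x \<star> q = e"
      using idempotent_multiple_or_nilpotent idem by metis
    moreover have "(x \<star> q) \<star> z = q \<star> (x \<star> z)" unfolding prod.assoc by (rule prod.left_commute)
    ultimately show False using that e by simp
  qed
  obtain a b c where abc: "indep3 a b c" by (rule indep3_exists)
  have "e \<noteq> 0" using e[of a] indep3_nonzero[OF abc] by auto
  then obtain v w where ind: "indep3 e v w" by (rule indep3_extend1)
  obtain s y where s: "y \<noteq> 0" "v \<star> y = s \<cdot> y" by (rule eigenvector)
  obtain t y' where t: "y' \<noteq> 0" "w \<star> y' = t \<cdot> y'" by (rule eigenvector)
  define m n where "m = v - s \<cdot> e" and "n = w - t \<cdot> e"
  have "n \<star> (n \<star> (n \<star> n)) = 0" "m \<star> y = 0"
    using s t singular[of n y'] by (simp_all add: m_def n_def bilinear e)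
  have "indep3 (v + (- s) \<cdot> e + 0 \<cdot> w) e w" by (rule indep3_add[OF indep3_permute(2)[OF ind]])
  then have "indep3 m e w" by (simp add: m_def)
  from indep3_add[OF indep3_permute(5)[OF this], of "- t" 0]
  have "indep3 n e m" by (simp add: n_def)
  then have ind: "indep3 e m n" by (rule indep3_permute)
  \<comment> \<open>The last nonzero vector among \<open>y, ny, n\<^sup>2y, n\<^sup>3y\<close>.\<close>
  obtain z where z: "z \<noteq> 0" "m \<star> z = 0" "n \<star> z = 0"
  proof -
    have step: "m \<star> (n \<star> u) = 0" if "m \<star> u = 0" for u
      using that by (subst prod.left_commute) simp
    note m1 = step[OF \<open>m \<star> y = 0\<close>] and m2 = step[OF step[OF \<open>m \<star> y = 0\<close>]]
      and m3 = step[OF step[OF step[OF \<open>m \<star> y = 0\<close>]]]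
    have "n \<star> (n \<star> (n \<star> (n \<star> y))) = (n \<star> (n \<star> (n \<star> n))) \<star> y" by (simp only: prod.assoc)
    then have "n \<star> (n \<star> (n \<star> (n \<star> y))) = 0" using \<open>n \<star> (n \<star> (n \<star> n)) = 0\<close> by simp
    then consider "n \<star> y = 0" | "n \<star> y \<noteq> 0" "n \<star> (n \<star> y) = 0"
      | "n \<star> (n \<star> y) \<noteq> 0" "n \<star> (n \<star> (n \<star> y)) = 0"
      | "n \<star> (n \<star> (n \<star> y)) \<noteq> 0" "n \<star> (n \<star> (n \<star> (n \<star> y))) = 0" by blast
    then show ?thesis
    proof cases
      case 1 show ?thesis by (rule that[OF s(1) \<open>m \<star> y = 0\<close> 1])
    next
      case 2 show ?thesis by (rule that[OF 2(1) m1 2(2)])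
    next
      case 3 show ?thesis by (rule that[OF 3(1) m2 3(2)])
    next
      case 4 show ?thesis by (rule that[OF 4(1) m3 4(2)])
    qed
  qed
  define S where "S = {x. x \<star> z = 0}"
  have S: "x \<in> S \<longleftrightarrow> (\<exists>\<beta> \<gamma>. x = \<beta> \<cdot> m + \<gamma> \<cdot> n)" for x
  proof
    assume "x \<in> S"
    obtain \<alpha> \<beta> \<gamma> where x: "x = \<alpha> \<cdot> e + \<beta> \<cdot> m + \<gamma> \<cdot> n" using ind by (rule indep3_span)
    then have "\<alpha> = 0" using \<open>x \<in> S\<close> by (simp add: S_def bilinear e z)
    then show "\<exists>\<beta> \<gamma>. x = \<beta> \<cdot> m + \<gamma> \<cdot> n" using x by auto
  qed (auto simp: S_def bilinear z)
  have closed: "x \<star> y \<in> S" if "x \<in> S" "y \<in> S" for x y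
    using that by (simp add: S_def prod.assoc)
  have nil: "x \<star> (x \<star> (x \<star> x)) = 0" if "x \<in> S" for x
    using that singular z by (simp add: S_def)
  obtain a b where ab: "a \<star> b = 0" "b \<star> b = 0" "a \<star> a = 0 \<or> a \<star> a = b"
    and ind: "indep3 e a b"
    using nil_plane_basis[OF ind S closed nil] by metis
  note ind = indep3_permute(3)[OF ind]
  from ab(3) show ?thesis
  proof
    assume "a \<star> a = 0"
    then have "isomorphic A (model L_A21u)"
      by (intro isomorphic_modelI[OF ind]) (simp_all add: comb_def e' ab)
    then show ?thesis ..
  next
    assume "a \<star> a = b"
    then have "isomorphic A (model L_A22u)"
      by (intro isomorphic_modelI[OF ind]) (simp_all add: comb_def e' ab)
    then show ?thesis ..
  qed
qed

text \<open>Once the rank two case is excluded, an idempotent \<open>f \<noteq> 0\<close> is the identity or has \<open>fA\<close> of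
  dimension \<open>1\<close>. With an identity \<open>e\<close> and \<open>f \<noteq> e\<close>, both \<open>f\<close> and \<open>e - f\<close> would be of the latter
  kind, although \<open>A = fA + (e - f)A\<close> has dimension \<open>3\<close>.\<close>

lemma classification: "\<exists>i. isomorphic A (model i)"
proof (rule ccontr)
  assume not: "\<not> (\<exists>i. isomorphic A (model i))"
  have dichotomy: "(\<forall>x. f \<star> x = x) \<or> (\<forall>x. \<exists>k. f \<star> x = k \<cdot> f)" if f: "f \<star> f = f" "f \<noteq> 0" for f
    using f
  proof (cases rule: peirce)
    case (1 v w)
    have "\<exists>k. f \<star> x = k \<cdot> f" for x
    proof -
      obtain \<alpha> \<beta> \<gamma> where "x = \<alpha> \<cdot> f + \<beta> \<cdot> v + \<gamma> \<cdot> w" using 1(1) by (rule indep3_span)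
      then have "f \<star> x = \<alpha> \<cdot> f" by (simp add: bilinear f 1)
      then show ?thesis ..
    qed
    then show ?thesis by blast
  next
    case (2 v w)
    then show ?thesis using classification_rank_two_idempotent[OF 2(1) f(1) 2(2,3)] not by blast
  qed simp
  obtain e where e: "e \<star> e = e" "e \<noteq> 0"
    using classification_nil idempotent_multiple_or_nilpotent not by metis
  show False
  proof (cases "\<exists>e. \<forall>x. e \<star> x = x")
    case True
    then obtain e where e: "\<And>x. e \<star> x = x" by blast
    then have e': "x \<star> e = x" for x using prod.commute by metis
    have "f = 0 \<or> f = e" if f: "f \<star> f = f" for f
    proof (rule ccontr)
      assume *: "\<not> (f = 0 \<or> f = e)"
      define g where "g = e - f"
      have g: "g \<star> g = g" "g \<noteq> 0" "g \<star> f = 0" "f \<star> g = 0"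
        using * by (auto simp: g_def bilinear e e' f)
      have "f \<star> e \<noteq> e" "g \<star> f \<noteq> f" using * g by (auto simp: e')
      then have fg: "\<exists>k. f \<star> x = k \<cdot> f" "\<exists>l. g \<star> x = l \<cdot> g" for x
        using dichotomy[OF f] dichotomy[OF g(1,2)] * by blast+
      have "g \<noteq> k \<cdot> f" for k
      proof
        assume "g = k \<cdot> f"
        then have "g \<star> g = k \<cdot> (f \<star> g)" by (simp only: prod_scale_left)
        then show False using g by simp
      qed
      then obtain w where ind: "indep3 f g w" using indep3_extend2[of f g] * by blast
      obtain k l where "f \<star> w = k \<cdot> f" "g \<star> w = l \<cdot> g" using fg by blast
      moreover have "w = f \<star> w + g \<star> w" by (simp add: g_def bilinear e)
      ultimately have "w = k \<cdot> f + l \<cdot> g" by simp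
      then have "(- k) \<cdot> f + (- l) \<cdot> g + 1 \<cdot> w = 0" by simp
      from indep3D(3)[OF ind this] show False by simp
    qed
    then show False using classification_local[of e] e not by blast
  next
    case False
    then have "\<exists>k. f \<star> x = k \<cdot> f" if "f \<star> f = f" "f \<noteq> 0" for f x
      using dichotomy[OF that] by blast
    then show False using classification_rank_one_idempotents[OF _ e] not by blast
  qed
qed

end

section \<open>Roots of cubics over the real and the complex numbers\<close>

text \<open>At \<open>M\<close> and \<open>-M\<close> the cubic term is at least as large as the sum of the others, so the values
  there have weakly opposite signs.\<close>

lemma cubic_root_real: "\<exists>t :: real. t ^ 3 + p * t ^ 2 + q * t + r = 0"
proof -
  define f where "f t = t ^ 3 + p * t ^ 2 + q * t + r" for t :: real
  define M where "M = 1 + \<bar>p\<bar> + \<bar>q\<bar> + \<bar>r\<bar>"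
  have M: "M \<ge> 1" by (simp add: M_def)
  have bound: "\<bar>p * t ^ 2 + q * t + r\<bar> \<le> M ^ 3" if "\<bar>t\<bar> = M" for t
  proof -
    have t2: "t ^ 2 = M ^ 2" using that by (metis power2_abs)
    have M2: "1 \<le> M ^ 2" "M \<le> M ^ 2" using M by (simp_all add: self_le_power)
    have "\<bar>p * t ^ 2 + q * t + r\<bar> \<le> \<bar>p\<bar> * M ^ 2 + \<bar>q\<bar> * M + \<bar>r\<bar>"
      using abs_triangle_ineq[of "p * t ^ 2 + q * t" r] abs_triangle_ineq[of "p * t ^ 2" "q * t"] that
      by (simp add: abs_mult t2)
    also have "\<dots> \<le> \<bar>p\<bar> * M ^ 2 + \<bar>q\<bar> * M ^ 2 + \<bar>r\<bar> * M ^ 2"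
      using M2 mult_left_mono[of M "M ^ 2" "\<bar>q\<bar>"] mult_left_mono[of 1 "M ^ 2" "\<bar>r\<bar>"] by simp
    also have "\<dots> = (M - 1) * M ^ 2" by (simp add: M_def algebra_simps)
    also have "\<dots> \<le> M ^ 3" using M by (simp add: power3_eq_cube power2_eq_square algebra_simps)
    finally show ?thesis .
  qed
  have "f (- M) \<le> 0" "0 \<le> f M"
    using bound[of M] bound[of "- M"] M by (simp_all add: f_def)
  moreover have "continuous_on {- M..M} f" unfolding f_def by (intro continuous_intros)
  ultimately obtain t where "f t = 0" using IVT'[of f "- M" 0 M] M by auto
  then show ?thesis by (auto simp: f_def)
qed

lemma cubic_root_complex: "\<exists>t :: complex. t ^ 3 + p * t ^ 2 + q * t + r = 0"
proof -
  have "\<not> constant (poly [:r, q, p, 1:])" by (simp add: constant_degree)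
  then obtain t where "poly [:r, q, p, 1:] t = 0" using fundamental_theorem_of_algebra by blast
  then have "t ^ 3 + p * t ^ 2 + q * t + r = 0"
    by (simp add: algebra_simps power2_eq_square power3_eq_cube)
  then show ?thesis ..
qed

lemma ca3_real:
  fixes A :: "(real, 'a::ab_group_add) alg"
  assumes "ca_algebra 3 A" shows "ca3 A"
proof -
  have "\<exists>s. s * s = b \<or> s * s = - b" for b :: real
    by (rule exI[of _ "sqrt \<bar>b\<bar>"]) (simp add: abs_if)
  then show ?thesis using assms cubic_root_real by unfold_locales
qed

lemma ca3_complex:
  fixes A :: "(complex, 'a::ab_group_add) alg"
  assumes "ca_algebra 3 A" shows "ca3 A"
proof -
  have "\<exists>s. s * s = b \<or> s * s = - b" for b :: complex
    by (rule exI[of _ "csqrt b"]) (simp flip: power2_eq_square)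
  then show ?thesis using assms cubic_root_complex by unfold_locales
qed

section \<open>Invariants\<close>

definition has_idempotent :: "('k, 'a::ab_group_add) alg \<Rightarrow> bool" where
  "has_idempotent A \<longleftrightarrow> (\<exists>e. mul A e e = e \<and> e \<noteq> 0)"

definition unital :: "('k, 'a) alg \<Rightarrow> bool" where
  "unital A \<longleftrightarrow> (\<exists>e. \<forall>x. mul A e x = x)"

text \<open>This says that \<open>A\<close> modulo its annihilator has dimension at most \<open>1\<close>, without mentioning
  dimensions.\<close>

definition rank_one :: "('k, 'a) alg \<Rightarrow> bool" where
  "rank_one A \<longleftrightarrow> (\<exists>x. \<forall>y. \<exists>c. \<forall>z. mul A y z = scl A c (mul A x z))"

definition cube_zero :: "('k, 'a::ab_group_add) alg \<Rightarrow> bool" where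
  "cube_zero A \<longleftrightarrow> (\<forall>x y z. mul A x (mul A y z) = 0)"

definition square_zero_annihilates :: "('k, 'a::ab_group_add) alg \<Rightarrow> bool" where
  "square_zero_annihilates A \<longleftrightarrow> (\<forall>x. mul A x x = 0 \<longrightarrow> (\<forall>y. mul A x y = 0))"

definition cube_zero_imp_square_zero :: "('k, 'a::ab_group_add) alg \<Rightarrow> bool" where
  "cube_zero_imp_square_zero A \<longleftrightarrow> (\<forall>x. mul A x (mul A x x) = 0 \<longrightarrow> mul A x x = 0)"

definition at_most_one_idempotent :: "('k, 'a::ab_group_add) alg \<Rightarrow> bool" where
  "at_most_one_idempotent A \<longleftrightarrow>
     (\<forall>e f. mul A e e = e \<longrightarrow> e \<noteq> 0 \<longrightarrow> mul A f f = f \<longrightarrow> f \<noteq> 0 \<longrightarrow> e = f)"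

definition has_cube_eq_minus :: "('k, 'a::ab_group_add) alg \<Rightarrow> bool" where
  "has_cube_eq_minus A \<longleftrightarrow> (\<exists>x. mul A x (mul A x x) = - x \<and> x \<noteq> 0)"

lemmas invariant_defs = has_idempotent_def unital_def rank_one_def cube_zero_def
  square_zero_annihilates_def cube_zero_imp_square_zero_def at_most_one_idempotent_def has_cube_eq_minus_def

lemma invariants_isomorphic:
  assumes iso: "isomorphic A B"
  shows "has_idempotent A = has_idempotent B" "unital A = unital B" "rank_one A = rank_one B"
    "cube_zero A = cube_zero B" "square_zero_annihilates A = square_zero_annihilates B"
    "cube_zero_imp_square_zero A = cube_zero_imp_square_zero B"
    "at_most_one_idempotent A = at_most_one_idempotent B" "has_cube_eq_minus A = has_cube_eq_minus B"
proof -
  obtain f where lin: "Vector_Spaces.linear (scl A) (scl B) f" and bij: "bij f"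
    and hom: "\<And>x y. f (mul A x y) = mul B (f x) (f y)"
    using iso by (auto simp: isomorphic_def)
  interpret Vector_Spaces.linear "scl A" "scl B" f by (rule lin)
  \<comment> \<open>All eight properties are carried over by letting the quantifiers range over images under \<open>f\<close>.\<close>
  have all: "(\<forall>y. P y) = (\<forall>x. P (f x))" and ex: "(\<exists>y. P y) = (\<exists>x. P (f x))" for P
    using bij by (metis bij_pointE)+
  have eq: "f x = f y \<longleftrightarrow> x = y" and eq0: "f x = 0 \<longleftrightarrow> x = 0" for x y
    using bij bij_is_inj inj_eq zero by metis+
  note rw = hom[symmetric] scale[symmetric] neg[symmetric] eq eq0
  show "has_idempotent A = has_idempotent B"
    unfolding invariant_defs
    unfolding ex[of "\<lambda>e. mul B e e = e \<and> e \<noteq> 0"]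
    unfolding rw ..
  show "unital A = unital B"
    unfolding invariant_defs
    unfolding ex[of "\<lambda>e. \<forall>x. mul B e x = x"]
    unfolding all[of "\<lambda>x. mul B e x = x" for e]
    unfolding rw ..
  show "rank_one A = rank_one B"
    unfolding invariant_defs
    unfolding ex[of "\<lambda>x. \<forall>y. \<exists>c. \<forall>z. mul B y z = scl B c (mul B x z)"]
    unfolding all[of "\<lambda>y. \<exists>c. \<forall>z. mul B y z = scl B c (mul B x z)" for x]
    unfolding all[of "\<lambda>z. mul B y z = scl B c (mul B x z)" for x y c]
    unfolding rw ..
  show "cube_zero A = cube_zero B"
    unfolding invariant_defs
    unfolding all[of "\<lambda>x. \<forall>y z. mul B x (mul B y z) = 0"]
    unfolding all[of "\<lambda>y. \<forall>z. mul B x (mul B y z) = 0" for x]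
    unfolding all[of "\<lambda>z. mul B x (mul B y z) = 0" for x y]
    unfolding rw ..
  show "square_zero_annihilates A = square_zero_annihilates B"
    unfolding invariant_defs
    unfolding all[of "\<lambda>x. mul B x x = 0 \<longrightarrow> (\<forall>y. mul B x y = 0)"]
    unfolding all[of "\<lambda>y. mul B x y = 0" for x]
    unfolding rw ..
  show "cube_zero_imp_square_zero A = cube_zero_imp_square_zero B"
    unfolding invariant_defs
    unfolding all[of "\<lambda>x. mul B x (mul B x x) = 0 \<longrightarrow> mul B x x = 0"]
    unfolding rw ..
  show "at_most_one_idempotent A = at_most_one_idempotent B"
    unfolding invariant_defs
    unfolding all[of "\<lambda>e. \<forall>f. mul B e e = e \<longrightarrow> e \<noteq> 0 \<longrightarrow> mul B f f = f \<longrightarrow> f \<noteq> 0 \<longrightarrow> e = f"]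
    unfolding all[of "\<lambda>f. mul B e e = e \<longrightarrow> e \<noteq> 0 \<longrightarrow> mul B f f = f \<longrightarrow> f \<noteq> 0 \<longrightarrow> e = f" for e]
    unfolding rw ..
  show "has_cube_eq_minus A = has_cube_eq_minus B"
    unfolding invariant_defs
    unfolding ex[of "\<lambda>x. mul B x (mul B x x) = - x \<and> x \<noteq> 0"]
    unfolding rw ..
qed

text \<open>Only the equality of values matters; the numbers are names for the leaves of the tree.\<close>

definition iso_class :: "('k, 'a::ab_group_add) alg \<Rightarrow> nat" where
  "iso_class A =
    (if has_idempotent A then
       if unital A then
         if square_zero_annihilates A then 0
         else if cube_zero_imp_square_zero A then (if at_most_one_idempotent A then 1 else 2)
         else 3
       else if square_zero_annihilates A then
         if cube_zero_imp_square_zero A then (if rank_one A then 4 else 5) else 6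
       else 7
     else if rank_one A then (if cube_zero_imp_square_zero A then 8 else 9)
     else if cube_zero A then 10
     else 11)"

lemma iso_class_isomorphic: "isomorphic A B \<Longrightarrow> iso_class A = iso_class B"
  by (simp add: iso_class_def invariants_isomorphic)

fun class_number :: "alg_name \<Rightarrow> nat" where
  "class_number L_A0u_A0u_A0u = 0"
| "class_number L_C_A0u = 0"
| "class_number L_A21u = 1"
| "class_number L_A1u_A0u = 2"
| "class_number L_A22u = 3"
| "class_number L_A0u_A1_A1 = 4"
| "class_number L_A0u_A0u_A1 = 5"
| "class_number L_C_A1 = 5"
| "class_number L_A22_A0u = 6"
| "class_number L_A1u_A1 = 7"
| "class_number L_A31 = 8"
| "class_number L_A32 = 9"
| "class_number L_A34 = 10"
| "class_number L_A35 = 10"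
| "class_number L_A33 = 11"

lemma UNIV_alg_name:
  "UNIV = {L_A31, L_A32, L_A33, L_A34, L_A35, L_A21u, L_A22u, L_A0u_A0u_A0u, L_A0u_A0u_A1,
    L_A0u_A1_A1, L_A1u_A1, L_A1u_A0u, L_C_A1, L_C_A0u, L_A22_A0u}"
  by (auto intro: alg_name.exhaust)

lemma class_number_eq_iff:
  "class_number i = class_number j \<longleftrightarrow>
    i = j \<or> {i, j} \<in> {{L_A34, L_A35}, {L_A0u_A0u_A0u, L_C_A0u}, {L_A0u_A0u_A1, L_C_A1}}"
  by (cases i; cases j; simp add: doubleton_eq_iff)

lemma has_idempotent_model:
  "has_idempotent (model i :: 'k::field_char_0 alg3) \<longleftrightarrow> i \<notin> {L_A31, L_A32, L_A33, L_A34, L_A35}"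
proof -
  have "has_idempotent (model i :: 'k alg3)" if "mprod i e e = e" "e \<noteq> 0" for e :: "'k ^ 3"
    using that by (auto simp: has_idempotent_def)
  from this[of "vector [1, 0, 0]"] this[of "vector [0, 1, 0]"] this[of "vector [0, 0, 1]"]
  show ?thesis by (cases i) (auto simp: vec_simps has_idempotent_def)
qed

lemma unital_model:
  assumes "i \<notin> {L_A31, L_A32, L_A33, L_A34, L_A35}"
  shows "unital (model i :: 'k::field_char_0 alg3) \<longleftrightarrow>
    i \<in> {L_A21u, L_A22u, L_A0u_A0u_A0u, L_A1u_A0u, L_C_A0u}"
proof -
  have yes: "unital (model i :: 'k alg3)" if "\<And>x. mprod i e x = x" for e :: "'k ^ 3"
    using that by (auto simp: unital_def)
  note yes = yes[of "vector [0, 0, 1]"] yes[of "vector [1, 1, 1]"] yes[of "vector [0, 1, 1]"]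
    yes[of "vector [1, 0, 1]"]
  have no: "\<not> unital (model i :: 'k alg3)" if "\<And>e. mprod i e x \<noteq> x" for x :: "'k ^ 3"
    using that by (auto simp: unital_def)
  show ?thesis
    using assms yes no[of "vector [0, 1, 0]"] no[of "vector [0, 0, 1]"]
    by (cases i) (simp_all add: vec_simps)
qed

lemma square_zero_annihilates_model:
  "i \<in> {L_A0u_A0u_A0u, L_C_A0u, L_A0u_A1_A1, L_A0u_A0u_A1, L_C_A1, L_A22_A0u} \<Longrightarrow>
    square_zero_annihilates (model i :: 'k::field_char_0 alg3)"
  "i \<in> {L_A21u, L_A22u, L_A1u_A0u, L_A1u_A1} \<Longrightarrow>
    \<not> square_zero_annihilates (model i :: 'k::field_char_0 alg3)"
proof -
  have "a = 0 \<and> b = 0" if "a * a - b * b = 0" "a * b + b * a = 0" for a b :: 'k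
  proof -
    have "2 * (a * b) = 0" using that(2) by (simp add: mult.commute)
    then show ?thesis using that(1) by auto
  qed
  then have sq: "v$1 = 0 \<and> v$2 = 0" if "v$1 * v$1 - v$2 * v$2 = 0" "v$1 * v$2 + v$2 * v$1 = 0"
    for v :: "'k ^ 3" using that by blast
  have "square_zero_annihilates (model i :: 'k alg3)" if i: "i \<in> {L_C_A0u, L_C_A1}"
    unfolding square_zero_annihilates_def model_simps
  proof (intro allI impI)
    fix v y :: "'k ^ 3" assume "mprod i v v = 0"
    then have comp: "mprod i v v $ n = 0" for n by simp
    have "v$1 * v$1 - v$2 * v$2 = 0" using comp[of 1] i by (elim insertE emptyE) simp_all
    moreover have "v$1 * v$2 + v$2 * v$1 = 0" using comp[of 2] i by (elim insertE emptyE) simp_all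
    ultimately have "v$1 = 0 \<and> v$2 = 0" by (rule sq)
    moreover have "i = L_C_A0u \<Longrightarrow> v$3 = 0" using comp[of 3] by simp
    ultimately show "mprod i v y = 0" using i by (auto simp: vec_simps)
  qed
  then show "square_zero_annihilates (model i :: 'k alg3)"
    if "i \<in> {L_A0u_A0u_A0u, L_C_A0u, L_A0u_A1_A1, L_A0u_A0u_A1, L_C_A1, L_A22_A0u}"
    using that by (auto simp: square_zero_annihilates_def vec_simps)
  have "\<not> square_zero_annihilates (model i :: 'k alg3)"
    if "mprod i x x = 0" "mprod i x y \<noteq> 0" for x y :: "'k ^ 3"
    using that by (auto simp: square_zero_annihilates_def)
  from this[of "vector [1, 0, 0]" "vector [0, 0, 1]"] this[of "vector [0, 1, 0]" "vector [0, 0, 1]"]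
    this[of "vector [1, 0, 0]" "vector [0, 1, 0]"]
  show "\<not> square_zero_annihilates (model i :: 'k alg3)" if "i \<in> {L_A21u, L_A22u, L_A1u_A0u, L_A1u_A1}"
    using that by (auto simp: vec_simps)
qed

text \<open>The table of the complex numbers is treated over a field that may contain \<open>\<i>\<close>, so \<open>a\<^sup>2 + b\<^sup>2 = 0\<close> does not
  settle the matter; the norm of \<open>(a + b\<i>)\<^sup>3\<close> is still \<open>(a\<^sup>2 + b\<^sup>2)\<^sup>3\<close>.\<close>

lemma cube_zero_imp_square_zero_model:
  "i \<in> {L_A31, L_A21u, L_A1u_A0u, L_A0u_A1_A1, L_A0u_A0u_A1, L_C_A1} \<Longrightarrow>
    cube_zero_imp_square_zero (model i :: 'k::field_char_0 alg3)"
  "i \<in> {L_A32, L_A22u, L_A22_A0u} \<Longrightarrow>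
    \<not> cube_zero_imp_square_zero (model i :: 'k::field_char_0 alg3)"
proof -
  have "a * a - b * b = 0 \<and> a * b + b * a = 0"
    if "a * (a * a - b * b) - b * (a * b + b * a) = 0" "a * (a * b + b * a) + b * (a * a - b * b) = 0"
    for a b :: 'k
  proof -
    have "(a * a + b * b) ^ 3 = (a * (a * a - b * b) - b * (a * b + b * a)) ^ 2
        + (a * (a * b + b * a) + b * (a * a - b * b)) ^ 2"
      by (simp add: power2_eq_square power3_eq_cube algebra_simps)
    also have "\<dots> = 0" unfolding that by simp
    finally have *: "a * a + b * b = 0" by simp
    have "a * (a * a - b * b) - b * (a * b + b * a) = a * (a * a + b * b) - 4 * (a * (b * b))"
      by (simp add: algebra_simps)
    then have "4 * (a * (b * b)) = 0" unfolding that(1) * by simp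
    then show ?thesis using * by auto
  qed
  then have "cube_zero_imp_square_zero (model L_C_A1 :: 'k alg3)"
    unfolding cube_zero_imp_square_zero_def model_simps
    by (simp only: mprod.simps vec_simps vector_3 zero_index) blast
  then show "cube_zero_imp_square_zero (model i :: 'k alg3)"
    if "i \<in> {L_A31, L_A21u, L_A1u_A0u, L_A0u_A1_A1, L_A0u_A0u_A1, L_C_A1}"
    using that by (auto simp: cube_zero_imp_square_zero_def vec_simps)
  have "\<not> cube_zero_imp_square_zero (model i :: 'k alg3)"
    if "mprod i x (mprod i x x) = 0" "mprod i x x \<noteq> 0" for x :: "'k ^ 3"
    using that by (auto simp: cube_zero_imp_square_zero_def)
  from this[of "vector [1, 0, 0]"]
  show "\<not> cube_zero_imp_square_zero (model i :: 'k alg3)" if "i \<in> {L_A32, L_A22u, L_A22_A0u}"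
    using that by (auto simp: vec_simps)
qed

lemma rank_one_model:
  "i \<in> {L_A31, L_A32, L_A0u_A1_A1} \<Longrightarrow> rank_one (model i :: 'k::field_char_0 alg3)"
  "i \<in> {L_A33, L_A34, L_A35, L_A0u_A0u_A1, L_C_A1} \<Longrightarrow>
    \<not> rank_one (model i :: 'k::field_char_0 alg3)"
proof -
  have "rank_one (model i :: 'k alg3)" if "\<And>y z :: 'k ^ 3. mprod i y z = y$1 *s mprod i (vector [1, 0, 0]) z"
    unfolding rank_one_def model_simps by (rule exI allI that)+
  then show "rank_one (model i :: 'k alg3)" if "i \<in> {L_A31, L_A32, L_A0u_A1_A1}"
    using that by (auto simp: vec_simps)
  let ?a = "vector [1, 0, 0] :: 'k ^ 3" and ?b = "vector [0, 1, 0] :: 'k ^ 3"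
  show "\<not> rank_one (model i :: 'k alg3)" if i: "i \<in> {L_A33, L_A34, L_A35, L_A0u_A0u_A1, L_C_A1}"
  proof
    assume "rank_one (model i :: 'k alg3)"
    then obtain x :: "'k ^ 3" where "\<forall>y. \<exists>c. \<forall>z. mprod i y z = c *s mprod i x z"
      unfolding rank_one_def model_simps by blast
    then obtain c d where c: "\<And>z. mprod i ?a z = c *s mprod i x z"
      and d: "\<And>z. mprod i ?b z = d *s mprod i x z" by metis
    \<comment> \<open>Multiplications by two elements would be proportional, so all their minors would vanish.\<close>
    have "(mprod i ?a z $ n) * (mprod i ?b z' $ m) = (mprod i ?b z $ n) * (mprod i ?a z' $ m)" for z z' n m
      unfolding c d by (simp add: mult_ac)
    note minor = this[of ?a 2 ?a 3] this[of ?a 3 ?b 3] this[of ?a 1 ?b 2] this[of ?a 1 ?a 2]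
    from i show False using minor by auto
  qed
qed

lemma cube_zero_model:
  "i \<in> {L_A34, L_A35} \<Longrightarrow> cube_zero (model i :: 'k::field_char_0 alg3)"
  "\<not> cube_zero (model L_A33 :: 'k::field_char_0 alg3)"
proof -
  show "cube_zero (model i :: 'k alg3)" if "i \<in> {L_A34, L_A35}"
    using that by (auto simp: cube_zero_def vec_simps)
  let ?x = "vector [1, 0, 0] :: 'k ^ 3"
  have "mprod L_A33 ?x (mprod L_A33 ?x ?x) \<noteq> 0" by (simp add: vec_simps)
  then show "\<not> cube_zero (model L_A33 :: 'k alg3)"
    unfolding cube_zero_def model_simps by blast
qed

lemma at_most_one_idempotent_model:
  "at_most_one_idempotent (model L_A21u :: 'k::field_char_0 alg3)"
  "\<not> at_most_one_idempotent (model L_A1u_A0u :: 'k::field_char_0 alg3)"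
proof -
  have "e = vector [0, 0, 1]" if "mprod L_A21u e e = e" "e \<noteq> 0" for e :: "'k ^ 3"
  proof -
    have comp: "mprod L_A21u e e $ n = e $ n" for n using that by simp
    have "e$3 = 0 \<or> e$3 = 1" using comp[of 3] by simp
    moreover have "e$1 * e$3 + e$3 * e$1 = e$1" "e$2 * e$3 + e$3 * e$2 = e$2"
      using comp[of 1] comp[of 2] by simp_all
    ultimately show ?thesis using \<open>e \<noteq> 0\<close> by (auto simp: vec_simps)
  qed
  then show "at_most_one_idempotent (model L_A21u :: 'k alg3)"
    unfolding at_most_one_idempotent_def model_simps by metis
  let ?e = "vector [0, 1, 0] :: 'k ^ 3" and ?f = "vector [0, 0, 1] :: 'k ^ 3"
  have "mprod L_A1u_A0u ?e ?e = ?e" "mprod L_A1u_A0u ?f ?f = ?f" "?e \<noteq> 0" "?f \<noteq> 0" "?e \<noteq> ?f"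
    by (simp_all add: vec_simps)
  then show "\<not> at_most_one_idempotent (model L_A1u_A0u :: 'k alg3)"
    unfolding at_most_one_idempotent_def model_simps by blast
qed

lemma iso_class_model: "iso_class (model i :: 'k::field_char_0 alg3) = class_number i"
  by (cases i) (simp_all add: iso_class_def has_idempotent_model unital_model
    square_zero_annihilates_model cube_zero_imp_square_zero_model rank_one_model cube_zero_model
    at_most_one_idempotent_model)

section \<open>Isomorphisms between the listed algebras\<close>

text \<open>The form \<open>x\<^sup>2 + y\<^sup>2\<close> has no isotropic vectors over the reals, unlike \<open>y\<^sup>2 - x\<^sup>2\<close>; the imaginary unit solves
  \<open>x\<^sup>3 = -x\<close>, which has only the solution \<open>0\<close> when the product is that of the reals or zero in each coordinate.\<close>

lemma isomorphic_model_real_iff: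
  "isomorphic (model i :: real alg3) (model j :: real alg3) \<longleftrightarrow> i = j"
proof
  assume iso: "isomorphic (model i :: real alg3) (model j :: real alg3)"
  then have "class_number i = class_number j"
    using iso_class_isomorphic[OF iso] by (simp add: iso_class_model)
  then have cases: "i = j \<or> i = L_A34 \<and> j = L_A35 \<or> i = L_A35 \<and> j = L_A34
      \<or> i \<in> {L_A0u_A0u_A0u, L_A0u_A0u_A1} \<and> j \<in> {L_C_A0u, L_C_A1}
      \<or> i \<in> {L_C_A0u, L_C_A1} \<and> j \<in> {L_A0u_A0u_A0u, L_A0u_A0u_A1}"
    by (auto simp: class_number_eq_iff doubleton_eq_iff)
  have sq34: "square_zero_annihilates (model L_A34 :: real alg3)"
    by (simp add: square_zero_annihilates_def vec_simps sum_squares_eq_zero_iff)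
  have sq35: "\<not> square_zero_annihilates (model L_A35 :: real alg3)"
  proof -
    let ?x = "vector [1, 1, 0] :: real ^ 3"
    have "mprod L_A35 ?x ?x = 0" "mprod L_A35 ?x (vector [0, 1, 0]) \<noteq> 0" by (simp_all add: vec_simps)
    then show ?thesis unfolding square_zero_annihilates_def model_simps by blast
  qed
  have cube: "has_cube_eq_minus (model k :: real alg3)" if "k \<in> {L_C_A0u, L_C_A1}" for k
  proof -
    let ?x = "vector [0, 1, 0] :: real ^ 3"
    have "mprod k ?x (mprod k ?x ?x) = - ?x" "?x \<noteq> 0" using that by (auto simp: vec_simps)
    then show ?thesis unfolding has_cube_eq_minus_def model_simps by blast
  qed
  have no_cube: "\<not> has_cube_eq_minus (model k :: real alg3)" if k: "k \<in> {L_A0u_A0u_A0u, L_A0u_A0u_A1}" for k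
  proof
    assume "has_cube_eq_minus (model k :: real alg3)"
    then obtain x :: "real ^ 3" where x: "mprod k x (mprod k x x) = - x" "x \<noteq> 0"
      unfolding has_cube_eq_minus_def model_simps by blast
    have *: "t = 0" if "t * (t * t) = - t" for t :: real
    proof -
      have "t * (1 + t * t) = 0" using that by (simp add: algebra_simps)
      then show ?thesis by (simp add: add_nonneg_eq_0_iff)
    qed
    have comp: "mprod k x (mprod k x x) $ n = - x $ n" for n using x(1) by simp
    have "x $ 1 = 0" using comp[of 1] k by (intro *) auto
    moreover have "x $ 2 = 0" using comp[of 2] k by (intro *) auto
    moreover have "x $ 3 = 0" using comp[of 3] k * by auto
    ultimately show False using x(2) by (simp add: vec_simps)
  qed
  show "i = j"
    using cases invariants_isomorphic(5,8)[OF iso] sq34 sq35 cube[of i] cube[of j] no_cube[of i] no_cube[of j]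
    by metis
next
  assume "i = j"
  then show "isomorphic (model i :: real alg3) (model j :: real alg3)"
    by (simp add: isomorphic_refl vec.vector_space_axioms)
qed


text \<open>Scaling by \<open>\<i>\<close> exchanges the two signs of a square. In two copies of the complex
  numbers, \<open>(1, 1)\<close> and \<open>(\<i>, -\<i>)\<close> multiply like \<open>1\<close> and \<open>\<i>\<close>.\<close>

lemma isomorphic_complex_pairs:
  "isomorphic (model L_A34 :: complex alg3) (model L_A35)"
  "isomorphic (model L_A0u_A0u_A0u :: complex alg3) (model L_C_A0u)"
  "isomorphic (model L_A0u_A0u_A1 :: complex alg3) (model L_C_A1)"
proof -
  interpret ca3 "model i :: complex alg3" for i by (rule ca3_complex[OF ca_algebra_model])
  have "indep3 L_A34 (vector [\<i>, 0, 0]) (vector [0, 1, 0]) (vector [0, 0, 1])"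
    by (simp add: indep3_def vec_simps)
  then show "isomorphic (model L_A34 :: complex alg3) (model L_A35)"
    by (rule isomorphic_modelI) (simp_all add: comb_def vec_simps)
  have *: "indep3 i (vector [1, 1, 0]) (vector [\<i>, - \<i>, 0]) (vector [0, 0, 1])" for i
  proof (rule indep3I)
    fix a b c :: complex
    assume "scl (model i) a (vector [1, 1, 0]) + scl (model i) b (vector [\<i>, - \<i>, 0])
      + scl (model i) c (vector [0, 0, 1]) = 0"
    then show "a = 0 \<and> b = 0 \<and> c = 0" by (auto simp: vec_simps)
  qed
  show "isomorphic (model L_A0u_A0u_A0u :: complex alg3) (model L_C_A0u)"
    by (rule isomorphic_modelI[OF *]) (simp_all add: comb_def vec_simps)
  show "isomorphic (model L_A0u_A0u_A1 :: complex alg3) (model L_C_A1)"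
    by (rule isomorphic_modelI[OF *]) (simp_all add: comb_def vec_simps)
qed

lemma isomorphic_model_complex_iff:
  "isomorphic (model i :: complex alg3) (model j :: complex alg3) \<longleftrightarrow> class_number i = class_number j"
proof
  assume "isomorphic (model i :: complex alg3) (model j :: complex alg3)"
  from iso_class_isomorphic[OF this] show "class_number i = class_number j"
    by (simp add: iso_class_model)
next
  assume "class_number i = class_number j"
  then consider "i = j" | "{i, j} \<in> {{L_A34, L_A35}, {L_A0u_A0u_A0u, L_C_A0u}, {L_A0u_A0u_A1, L_C_A1}}"
    unfolding class_number_eq_iff by blast
  then show "isomorphic (model i :: complex alg3) (model j :: complex alg3)"
  proof cases
    case 1
    then show ?thesis by (simp add: isomorphic_refl vec.vector_space_axioms)
  next
    case 2
    then show ?thesis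
      using isomorphic_complex_pairs isomorphic_complex_pairs[THEN isomorphic_sym]
      by (auto simp: doubleton_eq_iff)
  qed
qed

lemma card_ca_iso_classes:
  fixes M :: "'i \<Rightarrow> ('k::field, 'a::ab_group_add) alg" and c :: "'i \<Rightarrow> 'c"
  assumes ca: "\<And>i. ca_algebra n (M i)"
    and complete: "\<And>A :: ('k, 'a) alg. ca_algebra n A \<Longrightarrow> \<exists>i. isomorphic A (M i)"
    and iso: "\<And>i j. isomorphic (M i) (M j) \<longleftrightarrow> c i = c j"
  shows "card (ca_iso_classes n :: ('k, 'a) alg set set) = card (range c)"
proof -
  define K where "K A = {(A, B :: ('k, 'a) alg). isomorphic A B} `` {A}" for A :: "('k, 'a) alg"
  have K_iso: "K A = K B" if "isomorphic A B" for A B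
    using that isomorphic_sym isomorphic_trans unfolding K_def by blast
  have K_eq: "K (M i) = K (M j) \<longleftrightarrow> c i = c j" for i j
  proof
    assume "K (M i) = K (M j)"
    moreover have "M j \<in> K (M j)" using iso[of j j] by (simp add: K_def)
    ultimately show "c i = c j" using iso by (auto simp: K_def)
  qed (use iso K_iso in blast)
  have "(ca_iso_classes n :: ('k, 'a) alg set set) = K ` {A. ca_algebra n A}"
    by (auto simp: ca_iso_classes_def quotient_def K_def)
  also have "\<dots> = range (\<lambda>i. K (M i))"
    using complete K_iso ca by (auto simp: image_iff) metis
  finally have classes: "(ca_iso_classes n :: ('k, 'a) alg set set) = range (\<lambda>i. K (M i))" .
  define h where "h x = K (M (inv c x))" for x
  have h: "h (c i) = K (M i)" for i
    unfolding h_def K_eq by (simp add: f_inv_into_f)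
  have "inj_on h (range c)"
    by (auto simp: inj_on_def h K_eq)
  then have "card (h ` range c) = card (range c)" by (rule card_image)
  then show ?thesis by (simp add: classes image_image h)
qed

theorem mainTheorem2:
  shows
    "(\<forall>A :: (real, 'a::ab_group_add) alg. is_algebra A \<and> alg_dim A = 3 \<longrightarrow>
        (novikov A \<and> lie_abelian A \<longleftrightarrow> commutative A \<and> associative A))
     \<and> (\<forall>i. ca_algebra 3 (listed i))
     \<and> (\<forall>A :: (real, 'a) alg. ca_algebra 3 A \<longrightarrow> (\<exists>i. isomorphic A (listed i)))
     \<and> (\<forall>i j. isomorphic (listed i) (listed j) \<longleftrightarrow> i = j)
     \<and> card (ca_iso_classes 3 :: (real, real ^ 3) alg set set) = 15
     \<and> (\<forall>i. ca_algebra 3 (complexify (listed i)))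
     \<and> (\<forall>A :: (complex, 'b::ab_group_add) alg. ca_algebra 3 A \<longrightarrow>
          (\<exists>i. isomorphic A (complexify (listed i))))
     \<and> (\<forall>i j. isomorphic (complexify (listed i)) (complexify (listed j)) \<longleftrightarrow>
          i = j \<or> {i, j} \<in> {{L_A34, L_A35}, {L_A0u_A0u_A0u, L_C_A0u}, {L_A0u_A0u_A1, L_C_A1}})
     \<and> card (ca_iso_classes 3 :: (complex, complex ^ 3) alg set set) = 12"
proof (intro conjI allI impI)
  note cx = complexify_model[THEN isomorphic_sym]
  show "novikov A \<and> lie_abelian A \<longleftrightarrow> commutative A \<and> associative A"
    if "is_algebra A \<and> alg_dim A = 3" for A :: "(real, 'a) alg"
    using that novikov_lie_abelian_iff by blast
  show "ca_algebra 3 (listed i)" for i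
    unfolding listed_eq_model by (rule ca_algebra_model)
  show "\<exists>i. isomorphic A (listed i)" if "ca_algebra 3 A" for A :: "(real, 'a) alg"
    unfolding listed_eq_model using ca3_real[OF that] by (rule ca3.classification)
  show "isomorphic (listed i) (listed j) \<longleftrightarrow> i = j" for i j
    unfolding listed_eq_model by (rule isomorphic_model_real_iff)
  have "card (ca_iso_classes 3 :: (real, real ^ 3) alg set set) = card (range (\<lambda>i :: alg_name. i))"
    by (rule card_ca_iso_classes[OF ca_algebra_model
      ca3.classification[OF ca3_real] isomorphic_model_real_iff])
  then show "card (ca_iso_classes 3 :: (real, real ^ 3) alg set set) = 15"
    by (simp add: UNIV_alg_name)
  show "ca_algebra 3 (complexify (listed i))" for i
    unfolding listed_eq_model by (rule ca_algebra_isomorphic[OF cx ca_algebra_model]) simp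
  show "\<exists>i. isomorphic A (complexify (listed i))" if "ca_algebra 3 A" for A :: "(complex, 'b) alg"
    unfolding listed_eq_model
    using ca3.classification[OF ca3_complex[OF that]] isomorphic_trans[OF _ cx] by blast
  show "isomorphic (complexify (listed i)) (complexify (listed j)) \<longleftrightarrow>
      i = j \<or> {i, j} \<in> {{L_A34, L_A35}, {L_A0u_A0u_A0u, L_C_A0u}, {L_A0u_A0u_A1, L_C_A1}}" for i j
  proof -
    have "isomorphic (complexify (model i)) (complexify (model j)) \<longleftrightarrow>
        isomorphic (model i :: complex alg3) (model j :: complex alg3)"
      using isomorphic_trans cx complexify_model by metis
    then show ?thesis
      by (simp only: listed_eq_model isomorphic_model_complex_iff class_number_eq_iff)
  qed
  have "card (ca_iso_classes 3 :: (complex, complex ^ 3) alg set set) = card (range class_number)"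
    by (rule card_ca_iso_classes[OF ca_algebra_model
      ca3.classification[OF ca3_complex] isomorphic_model_complex_iff])
  also have "range class_number = {0, 1, 2, 3, 4, 5, 6, 7, 8, 9, 10, 11}"
    unfolding UNIV_alg_name by auto
  finally show "card (ca_iso_classes 3 :: (complex, complex ^ 3) alg set set) = 12"
    by simp
qed

end
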